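(* For any integer $k\ge 2$, $$\frac{1}{\sqrt{k^2-\frac18}}\;\le\; b^{\mathsf S}_k\;<\;\frac{1}{\sqrt{k^2-1}},$$ where $b^{\mathsf S}_k:=\sup\{b\in(0,1]\,:\, j(b)>k^2\pi^2\}$ and, for $b\in(0,1]$, $j(b):=\inf\{\lambda_1(\Omega)\,:\,\Omega\subset \mathbb{R}\times(0,b)\text{ open},\ |\Omega|\le b\}$.
   Context: For a nonempty open set $\Omega\subset\mathbb{R}^2$ (possibly unbounded), $\lambda_1(\Omega)$ denotes the first eigenvalue of the Dirichlet Laplacian, defined as the infimum of the Rayleigh quotient $\lambda_1(\Omega):=\inf_{u\in H^1_0(\Omega)\setminus\{0\}}\frac{\int_\Omega|\nabla u|^2\,dx}{\int_\Omega u^2\,dx}$. $|\Omega|$ denotes the two-dimensional Lebesgue measure (area) of $\Omega$. The infimum defining $j(b)$ is over nonempty open sets $\Omega$. *)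

theory Defs
  imports "HOL-Analysis.Analysis"
begin

text \<open>
  Sobolev spaces are set up on an open subset \<open>\<Omega>\<close> of an arbitrary Euclidean space. Elements of
  \<open>L\<^sup>2(\<Omega>)\<close> are represented by total functions that are Borel measurable on \<open>\<Omega>\<close>; their values
  outside \<open>\<Omega>\<close> are irrelevant, and functions that agree almost everywhere on \<open>\<Omega>\<close> stand for the
  same element.
\<close>

definition L2 :: "'a::euclidean_space set \<Rightarrow> ('a \<Rightarrow> 'b::euclidean_space) set" where
  "L2 \<Omega> = {f. set_borel_measurable lborel \<Omega> f \<and> set_integrable lborel \<Omega> (\<lambda>x. (norm (f x))\<^sup>2)}"

abbreviation partial :: "('a::euclidean_space \<Rightarrow> real) \<Rightarrow> 'a \<Rightarrow> 'a \<Rightarrow> real" where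
  "partial f i x \<equiv> frechet_derivative f (at x) i"

definition gradient :: "('a::euclidean_space \<Rightarrow> real) \<Rightarrow> 'a \<Rightarrow> 'a" where
  "gradient f x = (\<Sum>i\<in>Basis. partial f i x *\<^sub>R i)"

primrec cont_differentiable :: "nat \<Rightarrow> ('a::euclidean_space \<Rightarrow> real) \<Rightarrow> bool" where
  "cont_differentiable 0 f \<longleftrightarrow> continuous_on UNIV f"
| "cont_differentiable (Suc n) f \<longleftrightarrow>
     (\<forall>x. f differentiable at x) \<and> (\<forall>i\<in>Basis. cont_differentiable n (partial f i))"

text \<open>\<open>C\<^sub>c\<^sup>\<infinity>(\<Omega>)\<close>, its elements being extended by zero to the whole space.\<close>

definition test_functions :: "'a::euclidean_space set \<Rightarrow> ('a \<Rightarrow> real) set" where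
  "test_functions \<Omega> = {\<phi>. (\<forall>n. cont_differentiable n \<phi>) \<and>
     compact (closure {x. \<phi> x \<noteq> 0}) \<and> closure {x. \<phi> x \<noteq> 0} \<subseteq> \<Omega>}"

definition is_weak_gradient ::
  "'a::euclidean_space set \<Rightarrow> ('a \<Rightarrow> real) \<Rightarrow> ('a \<Rightarrow> 'a) \<Rightarrow> bool" where
  "is_weak_gradient \<Omega> u g \<longleftrightarrow> (\<forall>\<phi>\<in>test_functions \<Omega>. \<forall>i\<in>Basis.
     (LINT x:\<Omega>|lborel. u x * partial \<phi> i x) = - (LINT x:\<Omega>|lborel. (g x \<bullet> i) * \<phi> x))"

text \<open>
  \<open>has_H1_gradient \<Omega> u g\<close> says that \<open>u\<close> belongs to \<open>H\<^sup>1(\<Omega>)\<close> and \<open>g\<close> is its gradient. As usual \<open>g\<close>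
  is determined only up to a null set, which is why it is kept as an argument of the relation.
\<close>

definition has_H1_gradient ::
  "'a::euclidean_space set \<Rightarrow> ('a \<Rightarrow> real) \<Rightarrow> ('a \<Rightarrow> 'a) \<Rightarrow> bool" where
  "has_H1_gradient \<Omega> u g \<longleftrightarrow> u \<in> L2 \<Omega> \<and> g \<in> L2 \<Omega> \<and> is_weak_gradient \<Omega> u g"

text \<open>
  \<open>H\<^sup>1\<^sub>0(\<Omega>)\<close> is the closure of \<open>C\<^sub>c\<^sup>\<infinity>(\<Omega>)\<close> in \<open>H\<^sup>1(\<Omega>)\<close>; the sequence tending to 0 is the squared
  \<open>H\<^sup>1(\<Omega>)\<close> norm of \<open>\<phi> n - u\<close>.
\<close>

definition H10 :: "'a::euclidean_space set \<Rightarrow> ('a \<Rightarrow> real) set" where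
  "H10 \<Omega> = {u. \<exists>g. has_H1_gradient \<Omega> u g \<and>
     (\<exists>\<phi>. (\<forall>n. \<phi> n \<in> test_functions \<Omega>) \<and>
       (\<lambda>n::nat. (LINT x:\<Omega>|lborel. (\<phi> n x - u x)\<^sup>2) +
          (LINT x:\<Omega>|lborel. (norm (gradient (\<phi> n) x - g x))\<^sup>2)) \<longlonglongrightarrow> 0)}"

definition lambda1 :: "'a::euclidean_space set \<Rightarrow> real" where
  "lambda1 \<Omega> = Inf {(LINT x:\<Omega>|lborel. (norm (g x))\<^sup>2) / (LINT x:\<Omega>|lborel. (u x)\<^sup>2) | u g.
     u \<in> H10 \<Omega> \<and> has_H1_gradient \<Omega> u g \<and> \<not> (AE x in lborel. x \<in> \<Omega> \<longrightarrow> u x = 0)}"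

text \<open>
  The plane is \<open>real \<times> real\<close>, with the Euclidean norm. The area is taken in the extended
  nonnegative reals, so that sets of infinite measure are not admitted.
\<close>

definition j :: "real \<Rightarrow> real" where
  "j b = Inf {lambda1 \<Omega> | \<Omega> :: (real \<times> real) set.
     open \<Omega> \<and> \<Omega> \<noteq> {} \<and> \<Omega> \<subseteq> UNIV \<times> {0<..<b} \<and> emeasure lborel \<Omega> \<le> ennreal b}"

definition b_S :: "int \<Rightarrow> real" where
  "b_S k = Sup {b. 0 < b \<and> b \<le> 1 \<and> j b > (real_of_int k)\<^sup>2 * pi\<^sup>2}"

end

theory Submission
  imports Defs
begin

text \<open>
  Lower bound: for a test function \<open>\<phi>\<close> on \<open>\<Omega> \<subseteq> \<real> \<times> (0, b)\<close> put \<open>w(x) = \<integral> \<phi>(x, y)\<^sup>2 dy\<close>.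
  On the slice at \<open>x\<close>, of length \<open>l(x) = b m(x)\<close>, the one-dimensional Faber--Krahn inequality gives
  \<open>\<integral> (\<partial>\<^sub>y \<phi>)\<^sup>2 dy \<ge> (\<pi> / l)\<^sup>2 w \<ge> (\<pi> / b)\<^sup>2 (1 + 2 (1 - m)) w\<close>. Since \<open>\<integral> m dx \<le> 1\<close>, the function \<open>w\<close>
  cannot spread out for free, and a completion of squares shows that
  \<open>\<integral> |\<nabla>\<phi>|\<^sup>2 \<ge> (\<pi>\<^sup>2 / b\<^sup>2 + 3/2) \<integral> \<phi>\<^sup>2\<close>. As \<open>\<pi>\<^sup>2 / 8 < 3/2\<close>, this yields \<open>j(b) > k\<^sup>2 \<pi>\<^sup>2\<close> for
  \<open>b < (k\<^sup>2 - 1/8)\<^sup>-\<^sup>1\<^sup>/\<^sup>2\<close>.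

  Upper bound: the rectangle \<open>(0, 1) \<times> (0, b)\<close> has \<open>\<lambda>\<^sub>1 = \<pi>\<^sup>2 (1 + 1 / b\<^sup>2)\<close>, but it is not optimal.
  Replacing it by the set \<open>{u > \<epsilon>}\<close>, where \<open>u\<close> is its first eigenfunction, raises the Rayleigh
  quotient by \<open>O(\<epsilon>)\<close>, whereas the area saved at the corners is of order \<open>\<epsilon> ln (1 / \<epsilon>)\<close> and can be
  spent on a longer rectangle.
\<close>

section \<open>Smooth functions\<close>

text \<open>The tangent bound is linear in m, so the domain enters only through the integral of m:
  how its slices are arranged is irrelevant, and unbounded domains need no separate treatment. The
  gain 3/2 only has to exceed pi^2 / 8, the amount by which k^2 pi^2 exceeds pi^2 / b^2 at the
  claimed threshold. It is proved for test functions and passes to their closure.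

  The strict upper bound concerns a supremum, so one value of b strictly below the rectangle's
  threshold is required. A wider strip admits more domains, hence a single witness there bounds the
  whole set. To first order, lengthening the rectangle from 1 to 1 + z lowers its eigenvalue by 2
  pi^2 z and needs a relative area z, which the cut corners supply; with z proportional to e the
  truncation costs only pi^2 z. The truncation is built smooth and compactly supported from the
  outset, so that it is itself a test function and no mollification is involved.\<close>

definition smooth :: "('a::euclidean_space \<Rightarrow> real) \<Rightarrow> bool" where
  "smooth f \<longleftrightarrow> (\<forall>n. cont_differentiable n f)"

lemma smooth_coinduct:
  assumes "f \<in> X"
    and "\<And>f x. f \<in> X \<Longrightarrow> f differentiable at x"
    and "\<And>f i. f \<in> X \<Longrightarrow> i \<in> Basis \<Longrightarrow> partial f i \<in> X"
  shows "smooth f"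
proof -
  have "\<forall>f\<in>X. cont_differentiable n f" for n
  proof (induction n)
    case 0
    show ?case
      using assms(2) differentiable_imp_continuous_within
      by (force simp: continuous_on_eq_continuous_at)
  qed (use assms(2,3) in auto)
  then show ?thesis using assms(1) by (simp add: smooth_def)
qed

lemma smooth_coinduct_derivative:
  assumes "f \<in> X"
    and "\<And>f. f \<in> X \<Longrightarrow> \<exists>f'. (\<forall>x. (f has_derivative f' x) (at x)) \<and> (\<forall>i\<in>Basis. (\<lambda>x. f' x i) \<in> X)"
  shows "smooth f"
proof (rule smooth_coinduct[where X = X])
  fix f assume f: "f \<in> X"
  obtain f' where f': "\<And>x. (f has_derivative f' x) (at x)" "\<And>i. i \<in> Basis \<Longrightarrow> (\<lambda>x. f' x i) \<in> X"
    using assms(2)[OF f] by blast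
  show "f differentiable at x" for x
    using f'(1) by (auto simp: differentiable_def)
  have "partial f i = (\<lambda>x. f' x i)" for i
    using frechet_derivative_at[OF f'(1)] by metis
  then show "partial f i \<in> X" if "i \<in> Basis" for i
    using f'(2) that by simp
qed (rule assms(1))

lemma smooth_differentiable: "smooth f \<Longrightarrow> f differentiable at x"
  unfolding smooth_def by (metis cont_differentiable.simps(2))

lemma smooth_partial: "smooth f \<Longrightarrow> i \<in> Basis \<Longrightarrow> smooth (partial f i)"
  unfolding smooth_def by (metis cont_differentiable.simps(2))

lemma smooth_has_derivative: "smooth f \<Longrightarrow> (f has_derivative frechet_derivative f (at x)) (at x)"
  using frechet_derivative_works smooth_differentiable by blast

lemma smooth_continuous_on: "smooth f \<Longrightarrow> continuous_on A f"
  by (meson cont_differentiable.simps(1) continuous_on_subset smooth_def subset_UNIV)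

lemma smooth_const: "smooth (\<lambda>x. c)"
  by (rule smooth_coinduct_derivative[where X = "range (\<lambda>c x. c)"]) (auto intro!: exI[of _ "\<lambda>_ _. 0"])

text \<open>The product rule turns one product into a sum of two, so closure under addition is what
  makes the class stable under differentiation.\<close>

inductive_set sums_of_products :: "(('a::euclidean_space \<Rightarrow> real) \<times> ('a \<Rightarrow> real)) set \<Rightarrow> ('a \<Rightarrow> real) set"
  for X where
  product: "(f, g) \<in> X \<Longrightarrow> (\<lambda>x. f x * g x) \<in> sums_of_products X"
| plus: "f \<in> sums_of_products X \<Longrightarrow> g \<in> sums_of_products X \<Longrightarrow> (\<lambda>x. f x + g x) \<in> sums_of_products X"

lemma sums_of_products_derivative:
  assumes "f \<in> sums_of_products X"
    and "\<And>f g. (f, g) \<in> X \<Longrightarrow> \<exists>f' g'. (\<forall>x. (f has_derivative f' x) (at x)) \<and> (\<forall>x. (g has_derivative g' x) (at x))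
      \<and> (\<forall>i\<in>Basis. ((\<lambda>x. f' x i), g) \<in> X \<and> (f, (\<lambda>x. g' x i)) \<in> X)"
  shows "\<exists>f'. (\<forall>x. (f has_derivative f' x) (at x)) \<and> (\<forall>i\<in>Basis. (\<lambda>x. f' x i) \<in> sums_of_products X)"
  using assms(1)
proof induction
  case (product f g)
  obtain f' g' where f': "\<And>x. (f has_derivative f' x) (at x)" and g': "\<And>x. (g has_derivative g' x) (at x)"
    and X: "\<And>i. i \<in> Basis \<Longrightarrow> ((\<lambda>x. f' x i), g) \<in> X" "\<And>i. i \<in> Basis \<Longrightarrow> (f, (\<lambda>x. g' x i)) \<in> X"
    using assms(2)[OF product] by blast
  have "((\<lambda>x. f x * g x) has_derivative (\<lambda>h. f x * g' x h + f' x h * g x)) (at x)" for x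
    using has_derivative_mult[OF f' g'] .
  then show ?case
    by (intro exI[of _ "\<lambda>x h. f x * g' x h + f' x h * g x"])
      (auto intro!: sums_of_products.intros X)
next
  case (plus f g)
  then obtain f' g' where "\<And>x. (f has_derivative f' x) (at x)" "\<And>x. (g has_derivative g' x) (at x)"
    "\<And>i. i \<in> Basis \<Longrightarrow> (\<lambda>x. f' x i) \<in> sums_of_products X"
    "\<And>i. i \<in> Basis \<Longrightarrow> (\<lambda>x. g' x i) \<in> sums_of_products X"
    by blast
  then show ?case
    by (intro exI[of _ "\<lambda>x h. f' x h + g' x h"])
      (auto intro!: sums_of_products.intros has_derivative_add)
qed

lemma smooth_mult: "smooth f \<Longrightarrow> smooth g \<Longrightarrow> smooth (\<lambda>x. f x * g x)"
proof (rule smooth_coinduct_derivative[where X = "sums_of_products {(f, g). smooth f \<and> smooth g}"])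
  fix h :: "'a \<Rightarrow> real" assume "h \<in> sums_of_products {(f, g). smooth f \<and> smooth g}"
  then show "\<exists>h'. (\<forall>x. (h has_derivative h' x) (at x)) \<and>
      (\<forall>i\<in>Basis. (\<lambda>x. h' x i) \<in> sums_of_products {(f, g). smooth f \<and> smooth g})"
  proof (rule sums_of_products_derivative)
    fix f g :: "'a \<Rightarrow> real" assume "(f, g) \<in> {(f, g). smooth f \<and> smooth g}"
    then show "\<exists>f' g'. (\<forall>x. (f has_derivative f' x) (at x)) \<and> (\<forall>x. (g has_derivative g' x) (at x))
      \<and> (\<forall>i\<in>Basis. ((\<lambda>x. f' x i), g) \<in> {(f, g). smooth f \<and> smooth g} \<and> (f, (\<lambda>x. g' x i)) \<in> {(f, g). smooth f \<and> smooth g})"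
      by (intro exI[of _ "\<lambda>x. frechet_derivative f (at x)"] exI[of _ "\<lambda>x. frechet_derivative g (at x)"])
        (auto simp: smooth_has_derivative smooth_partial)
  qed
qed (auto intro!: sums_of_products.intros)

lemma smooth_add: "smooth f \<Longrightarrow> smooth g \<Longrightarrow> smooth (\<lambda>x. f x + g x)"
proof (rule smooth_coinduct_derivative[where X = "{\<lambda>x. f x + g x |f g. smooth f \<and> smooth g}"])
  fix h :: "'a \<Rightarrow> real" assume "h \<in> {\<lambda>x. f x + g x |f g. smooth f \<and> smooth g}"
  then obtain f g where h: "h = (\<lambda>x. f x + g x)" and fg: "smooth f" "smooth g" by blast
  show "\<exists>h'. (\<forall>x. (h has_derivative h' x) (at x)) \<and>
      (\<forall>i\<in>Basis. (\<lambda>x. h' x i) \<in> {\<lambda>x. f x + g x |f g. smooth f \<and> smooth g})"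
    unfolding h using fg smooth_partial
    by (intro exI[of _ "\<lambda>x v. partial f v x + partial g v x"])
      (force intro!: has_derivative_add smooth_has_derivative)
qed auto

text \<open>A cosine is a sine shifted by pi / 2, so with a free amplitude and a free phase the
  class is closed under differentiation.\<close>

lemma smooth_sin: "smooth (\<lambda>x. sin (x \<bullet> w + d))"
proof (rule smooth_coinduct_derivative[where X = "{\<lambda>x. c * sin (x \<bullet> w + d) |c d. True}"])
  show "(\<lambda>x. sin (x \<bullet> w + d)) \<in> {\<lambda>x. c * sin (x \<bullet> w + d) |c d. True}"
    by (force intro: exI[of _ 1])
  fix f assume "f \<in> {\<lambda>x. c * sin (x \<bullet> w + d) |c d. True}"
  then obtain c d where f: "f = (\<lambda>x. c * sin (x \<bullet> w + d))" by blast
  have "(\<lambda>x. c * cos (x \<bullet> w + d) * (i \<bullet> w)) \<in> {\<lambda>x. c * sin (x \<bullet> w + d) |c d. True}" for i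
    by (rule CollectI, intro exI[of _ "c * (i \<bullet> w)"] exI[of _ "d + pi / 2"])
      (auto simp: sin_add add.assoc[symmetric])
  moreover have "(f has_derivative (\<lambda>h. c * cos (x \<bullet> w + d) * (h \<bullet> w))) (at x)" for x
    unfolding f by (auto intro!: derivative_eq_intros)
  ultimately show "\<exists>f'. (\<forall>x. (f has_derivative f' x) (at x)) \<and>
      (\<forall>i\<in>Basis. (\<lambda>x. f' x i) \<in> {\<lambda>x. c * sin (x \<bullet> w + d) |c d. True})"
    by (intro exI[of _ "\<lambda>x h. c * cos (x \<bullet> w + d) * (h \<bullet> w)"]) auto
qed

text \<open>The partial derivatives are affine, which is why the class carries a linear term and
  allows the quadratic coefficient to be 0.\<close>

lemma smooth_dist_squared: "smooth (\<lambda>x. a + c * ((x - p) \<bullet> (x - p)))"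
proof (rule smooth_coinduct_derivative[where X = "{\<lambda>x. a + x \<bullet> v + c * ((x - p) \<bullet> (x - p)) |a v c. True}"])
  show "(\<lambda>x. a + c * ((x - p) \<bullet> (x - p))) \<in> {\<lambda>x. a + x \<bullet> v + c * ((x - p) \<bullet> (x - p)) |a v c. True}"
    by (force intro: exI[of _ 0])
  fix f assume "f \<in> {\<lambda>x. a + x \<bullet> v + c * ((x - p) \<bullet> (x - p)) |a v c. True}"
  then obtain a v c where f: "f = (\<lambda>x. a + x \<bullet> v + c * ((x - p) \<bullet> (x - p)))" by blast
  have "(\<lambda>x. i \<bullet> v + c * (2 * (i \<bullet> (x - p)))) \<in> {\<lambda>x. a + x \<bullet> v + c * ((x - p) \<bullet> (x - p)) |a v c. True}" for i
    by (rule CollectI, intro exI[of _ "i \<bullet> v - 2 * c * (i \<bullet> p)"] exI[of _ "(2 * c) *\<^sub>R i"] exI[of _ 0])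
      (auto simp: fun_eq_iff algebra_simps inner_diff_right inner_commute)
  moreover have "(f has_derivative (\<lambda>h. h \<bullet> v + c * (2 * (h \<bullet> (x - p))))) (at x)" for x
    unfolding f by (auto intro!: derivative_eq_intros simp: inner_commute algebra_simps)
  ultimately show "\<exists>f'. (\<forall>x. (f has_derivative f' x) (at x)) \<and>
      (\<forall>i\<in>Basis. (\<lambda>x. f' x i) \<in> {\<lambda>x. a + x \<bullet> v + c * ((x - p) \<bullet> (x - p)) |a v c. True})"
    by (intro exI[of _ "\<lambda>x h. h \<bullet> v + c * (2 * (h \<bullet> (x - p)))"]) auto
qed

text \<open>
  Functions of this form are closed under differentiation, the polynomial \<open>p\<close> becoming
  \<open>flat_deriv e p\<close>. The case \<open>p = 1\<close> is a smooth substitute for the positive part, with derivative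
  in \<open>[0, 1]\<close>, so that composing with it does not increase the Dirichlet energy.
\<close>

definition flat_function :: "real \<Rightarrow> real poly \<Rightarrow> real \<Rightarrow> real" where
  "flat_function e p t = (if t \<le> 0 then 0 else t * poly p (1 / t) * exp (- (e / t)))"

definition flat_deriv :: "real \<Rightarrow> real poly \<Rightarrow> real poly" where
  "flat_deriv e p = [:0, 1:] * p - [:0, 0, 1:] * pderiv p + [:0, 0, e:] * p"

lemma poly_exp_tendsto_0:
  fixes e :: real
  assumes "e > 0"
  shows "((\<lambda>s. poly p s * exp (- (e * s))) \<longlongrightarrow> 0) at_top"
proof -
  have mono: "((\<lambda>s. s ^ n * exp (- (e * s))) \<longlongrightarrow> 0) at_top" for n
  proof -
    have "filterlim (\<lambda>s. e * s) at_top at_top"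
      using assms by (intro filterlim_tendsto_pos_mult_at_top[of _ e]) (auto simp: filterlim_ident)
    then have "((\<lambda>s. (e * s) ^ n / exp (e * s)) \<longlongrightarrow> 0) at_top"
      by (rule filterlim_compose[OF tendsto_power_div_exp_0])
    then have "((\<lambda>s. (1 / e ^ n) * ((e * s) ^ n / exp (e * s))) \<longlongrightarrow> (1 / e ^ n) * 0) at_top"
      by (intro tendsto_intros)
    then show ?thesis
      using assms by (simp add: power_mult_distrib exp_minus field_simps)
  qed
  have "((\<lambda>s. \<Sum>i\<le>degree p. coeff p i * (s ^ i * exp (- (e * s)))) \<longlongrightarrow> (\<Sum>i\<le>degree p. coeff p i * 0)) at_top"
    by (intro tendsto_intros mono)
  then show ?thesis
    by (simp add: poly_altdef sum_distrib_right mult.assoc)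
qed

text \<open>For t > 0 put s = 1 / t: differentiating t p(s) exp (- e s) gives t (s p - s^2 p' + e
  s^2 p) exp (- e s). At t = 0 the right difference quotient is p(s) exp (- e s) with s tending to
  infinity, where the exponential beats the polynomial.\<close>

lemma flat_function_deriv:
  assumes "e > 0"
  shows "(flat_function e p has_field_derivative flat_function e (flat_deriv e p) t) (at t)"
proof -
  consider "t < 0" | "t = 0" | "t > 0" by linarith
  then show ?thesis
  proof cases
    case 1
    have "((\<lambda>t. 0) has_field_derivative 0) (at t)" by simp
    then show ?thesis
      using 1
      by (rule_tac has_field_derivative_transform_within_open[of _ _ _ "{..<0}"])
        (auto simp: flat_function_def)
  next
    case 3
    have "((\<lambda>t. t * poly p (1 / t) * exp (- (e / t))) has_field_derivative
        t * poly (flat_deriv e p) (1 / t) * exp (- (e / t))) (at t)"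
      unfolding flat_deriv_def using 3
      by (auto intro!: derivative_eq_intros DERIV_chain2[OF poly_DERIV]
          simp: field_simps power2_eq_square)
    then show ?thesis
      using 3
      by (rule_tac has_field_derivative_transform_within_open[of _ _ _ "{0<..}"])
        (auto simp: flat_function_def)
  next
    case 2
    have "((\<lambda>h. poly p (1 / h) * exp (- (e / h))) \<longlongrightarrow> 0) (at_right 0)"
      using filterlim_compose[OF poly_exp_tendsto_0[OF assms, of p] filterlim_inverse_at_top_right]
      by (simp add: divide_inverse)
    then have "((\<lambda>h. flat_function e p h / h) \<longlongrightarrow> 0) (at_right 0)"
      by (rule Lim_transform_eventually)
        (auto simp: flat_function_def eventually_at intro!: exI[of _ 1])
    moreover have "((\<lambda>h. flat_function e p h / h) \<longlongrightarrow> 0) (at_left 0)"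
      by (rule Lim_transform_eventually[of "\<lambda>_. 0"])
        (auto simp: flat_function_def eventually_at intro!: exI[of _ 1])
    ultimately have "((\<lambda>h. flat_function e p h / h) \<longlongrightarrow> 0) (at 0)"
      by (simp add: filterlim_at_split)
    then show ?thesis
      using 2 by (simp add: DERIV_def) (simp add: flat_function_def)
  qed
qed

text \<open>The factor \<open>g\<close> absorbs the partial derivatives of \<open>h\<close> that the
  chain rule produces, and the sums come from the product rule.\<close>

inductive_set flat_sums :: "real \<Rightarrow> 'a::euclidean_space set \<Rightarrow> ('a \<Rightarrow> real) \<Rightarrow> ('a \<Rightarrow> real) set"
  for e S h where
  product: "smooth g \<Longrightarrow> (\<lambda>x. (if x \<in> S then flat_function e p (h x) else 0) * g x) \<in> flat_sums e S h"
| plus: "f \<in> flat_sums e S h \<Longrightarrow> g \<in> flat_sums e S h \<Longrightarrow> (\<lambda>x. f x + g x) \<in> flat_sums e S h"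

text \<open>Since \<open>h\<close> is negative on the boundary of \<open>S\<close>, the function
  already vanishes near each boundary point, so extending it by zero creates no singularity.\<close>

lemma flat_cutoff_has_derivative:
  assumes "e > 0" "open S" "smooth h" and neg: "\<And>x. x \<in> closure S - S \<Longrightarrow> h x < 0"
  shows "((\<lambda>x. if x \<in> S then flat_function e p (h x) else 0) has_derivative
    (\<lambda>v. (if x \<in> S then flat_function e (flat_deriv e p) (h x) else 0) * frechet_derivative h (at x) v)) (at x)"
    (is "(?f has_derivative ?f') _")
proof (cases "x \<in> S")
  case True
  have "((\<lambda>x. flat_function e p (h x)) has_derivative
    (\<lambda>v. flat_function e (flat_deriv e p) (h x) * frechet_derivative h (at x) v)) (at x)"
    using has_derivative_compose[OF smooth_has_derivative[OF assms(3), of x]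
        flat_function_deriv[OF assms(1), of p "h x", unfolded has_field_derivative_def]] .
  then have "(?f has_derivative (\<lambda>v. flat_function e (flat_deriv e p) (h x) * frechet_derivative h (at x) v)) (at x)"
    by (rule has_derivative_transform_within_open[OF _ assms(2) True]) auto
  then show ?thesis using True by simp
next
  case False
  have "open ({x. h x < 0} \<union> - closure S)"
    by (intro open_Un open_Collect_less smooth_continuous_on smooth_const assms) auto
  moreover have "x \<in> {x. h x < 0} \<union> - closure S" using False neg by auto
  moreover have "((\<lambda>x. 0) has_derivative (\<lambda>v. 0)) (at x)" by simp
  moreover have "0 = ?f y" if "y \<in> {x. h x < 0} \<union> - closure S" for y
    using that closure_subset[of S] by (auto simp: flat_function_def)
  ultimately have "(?f has_derivative (\<lambda>v. 0)) (at x)"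
    using has_derivative_transform_within_open[of "\<lambda>x. 0" "\<lambda>v. 0" x UNIV "{x. h x < 0} \<union> - closure S" ?f]
    by simp
  then show ?thesis using False by simp
qed

lemma flat_sums_derivative:
  assumes "f \<in> flat_sums e S h" "e > 0" "open S" "smooth h" "\<And>x. x \<in> closure S - S \<Longrightarrow> h x < 0"
  shows "\<exists>f'. (\<forall>x. (f has_derivative f' x) (at x)) \<and> (\<forall>i\<in>Basis. (\<lambda>x. f' x i) \<in> flat_sums e S h)"
  using assms(1)
proof induction
  case (product g p)
  let ?f = "\<lambda>p x. if x \<in> S then flat_function e p (h x) else 0"
  have "((\<lambda>x. ?f p x * g x) has_derivative
      (\<lambda>v. ?f p x * partial g v x + ?f (flat_deriv e p) x * partial h v x * g x)) (at x)" for x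
    using has_derivative_mult[OF flat_cutoff_has_derivative[OF assms(2-5)] smooth_has_derivative[OF product]] .
  moreover have "(\<lambda>x. ?f p x * partial g i x + ?f (flat_deriv e p) x * (partial h i x * g x)) \<in> flat_sums e S h"
    if "i \<in> Basis" for i
    using that product assms(4) by (intro flat_sums.intros smooth_mult smooth_partial)
  ultimately show ?case
    by (intro exI[of _ "\<lambda>x v. ?f p x * partial g v x + ?f (flat_deriv e p) x * partial h v x * g x"])
      (auto simp: mult.assoc)
next
  case (plus f g)
  then obtain f' g' where "\<And>x. (f has_derivative f' x) (at x)" "\<And>x. (g has_derivative g' x) (at x)"
    "\<And>i. i \<in> Basis \<Longrightarrow> (\<lambda>x. f' x i) \<in> flat_sums e S h"
    "\<And>i. i \<in> Basis \<Longrightarrow> (\<lambda>x. g' x i) \<in> flat_sums e S h"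
    by blast
  then show ?case
    by (intro exI[of _ "\<lambda>x h. f' x h + g' x h"])
      (auto intro!: flat_sums.plus has_derivative_add)
qed

lemma smooth_flat_cutoff:
  assumes "e > 0" "open S" "smooth h" "\<And>x. x \<in> closure S - S \<Longrightarrow> h x < 0"
  shows "smooth (\<lambda>x. if x \<in> S then flat_function e p (h x) else 0)"
proof (rule smooth_coinduct_derivative[where X = "flat_sums e S h"])
  show "(\<lambda>x. if x \<in> S then flat_function e p (h x) else 0) \<in> flat_sums e S h"
    using flat_sums.product[OF smooth_const[of 1]] by simp
qed (rule flat_sums_derivative[OF _ assms])

text \<open>Everything rests on 1 + x \<le> exp x. With x = - e / t it bounds the loss against t by
  e; with x = e / t it bounds the derivative (1 + e / t) exp (- e / t) by 1.\<close>

lemma flat_function_1: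
  assumes "e > 0"
  shows "t - e \<le> flat_function e 1 t"
    and "0 \<le> flat_function e (flat_deriv e 1) t" "flat_function e (flat_deriv e 1) t \<le> 1"
    and "flat_function e 1 t \<ge> 0" "flat_function e 1 t > 0 \<longleftrightarrow> t > 0"
proof -
  have "t - e \<le> t * exp (- (e / t))" if "t > 0"
  proof -
    have "t * (1 + (- (e / t))) \<le> t * exp (- (e / t))"
      using that by (intro mult_left_mono exp_ge_add_one_self) auto
    moreover have "t * (1 + (- (e / t))) = t - e" using that by (simp add: field_simps)
    ultimately show ?thesis by simp
  qed
  then show "t - e \<le> flat_function e 1 t" using assms by (auto simp: flat_function_def)
  have eq: "flat_function e (flat_deriv e 1) t = (1 + e / t) * exp (- (e / t))" if "t > 0"
    using that by (simp add: flat_function_def flat_deriv_def field_simps power2_eq_square)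
  have "(1 + e / t) * exp (- (e / t)) \<le> exp (e / t) * exp (- (e / t))"
    by (intro mult_right_mono exp_ge_add_one_self) auto
  then show "flat_function e (flat_deriv e 1) t \<le> 1"
    using eq by (cases "t > 0") (auto simp: exp_minus flat_function_def)
  show "0 \<le> flat_function e (flat_deriv e 1) t"
    using eq assms by (cases "t > 0") (auto simp: flat_function_def)
qed (auto simp: flat_function_def)

section \<open>Sobolev spaces\<close>

lemma L2_diff:
  assumes "f \<in> L2 \<Omega>" "g \<in> L2 \<Omega>"
  shows "(\<lambda>x. f x - g x) \<in> L2 \<Omega>"
proof -
  have m: "(\<lambda>x. indicator \<Omega> x *\<^sub>R f x) \<in> borel_measurable lborel"
    "(\<lambda>x. indicator \<Omega> x *\<^sub>R g x) \<in> borel_measurable lborel"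
    and i: "set_integrable lborel \<Omega> (\<lambda>x. (norm (f x))\<^sup>2)" "set_integrable lborel \<Omega> (\<lambda>x. (norm (g x))\<^sup>2)"
    using assms by (auto simp: L2_def set_borel_measurable_def)
  have m': "(\<lambda>x. indicator \<Omega> x *\<^sub>R (f x - g x)) \<in> borel_measurable lborel"
    using borel_measurable_diff[OF m] by (simp add: scaleR_diff_right)
  have bound: "(norm (f x - g x))\<^sup>2 \<le> 2 * (norm (f x))\<^sup>2 + 2 * (norm (g x))\<^sup>2" for x
  proof -
    have "(norm (f x - g x))\<^sup>2 \<le> (norm (f x) + norm (g x))\<^sup>2"
      by (intro power_mono norm_triangle_ineq4) auto
    also have "\<dots> \<le> 2 * (norm (f x))\<^sup>2 + 2 * (norm (g x))\<^sup>2"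
      using sum_squares_bound[of "norm (f x)" "norm (g x)"] by (simp add: power2_sum)
    finally show ?thesis .
  qed
  have "set_integrable lborel \<Omega> (\<lambda>x. 2 * (norm (f x))\<^sup>2 + 2 * (norm (g x))\<^sup>2)"
    using i by (intro set_integral_add set_integrable_mult_right) auto
  moreover have "(\<lambda>x. indicator \<Omega> x *\<^sub>R (norm (f x - g x))\<^sup>2) = (\<lambda>x. (norm (indicator \<Omega> x *\<^sub>R (f x - g x)))\<^sup>2)"
    by (auto simp: indicator_def)
  moreover have "\<dots> \<in> borel_measurable lborel" using m' by measurable
  ultimately have "set_integrable lborel \<Omega> (\<lambda>x. (norm (f x - g x))\<^sup>2)"
    unfolding set_integrable_def
    by (rule_tac Bochner_Integration.integrable_bound) (auto simp: indicator_def bound)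
  then show ?thesis using m' by (simp add: L2_def set_borel_measurable_def)
qed

lemma L2_inner_integrable:
  assumes "f \<in> L2 \<Omega>" "g \<in> L2 \<Omega>"
  shows "set_integrable lborel \<Omega> (\<lambda>x. f x \<bullet> g x)"
proof -
  have i: "set_integrable lborel \<Omega> (\<lambda>x. (norm (f x))\<^sup>2)" "set_integrable lborel \<Omega> (\<lambda>x. (norm (g x))\<^sup>2)"
    "set_integrable lborel \<Omega> (\<lambda>x. (norm (f x - g x))\<^sup>2)"
    using assms L2_diff[OF assms] by (auto simp: L2_def)
  have "set_integrable lborel \<Omega> (\<lambda>x. (1 / 2) * ((norm (f x))\<^sup>2 + (norm (g x))\<^sup>2 - (norm (f x - g x))\<^sup>2))"
    using i by (intro set_integrable_mult_right set_integral_diff set_integral_add) auto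
  moreover have "(1 / 2) * ((norm (f x))\<^sup>2 + (norm (g x))\<^sup>2 - (norm (f x - g x))\<^sup>2) = f x \<bullet> g x" for x
    by (simp add: power2_norm_eq_inner inner_diff_left inner_diff_right inner_commute)
  ultimately show ?thesis by simp
qed

lemma L2_inner_const:
  assumes "f \<in> L2 \<Omega>"
  shows "(\<lambda>x. f x \<bullet> c) \<in> L2 \<Omega>"
proof -
  have m: "(\<lambda>x. indicator \<Omega> x *\<^sub>R f x) \<in> borel_measurable lborel"
    and i: "set_integrable lborel \<Omega> (\<lambda>x. (norm (f x))\<^sup>2)"
    using assms by (auto simp: L2_def set_borel_measurable_def)
  have m': "(\<lambda>x. indicator \<Omega> x *\<^sub>R (f x \<bullet> c)) \<in> borel_measurable lborel"
    using borel_measurable_inner[OF m borel_measurable_const[of c]] by simp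
  have "set_integrable lborel \<Omega> (\<lambda>x. (norm c)\<^sup>2 * (norm (f x))\<^sup>2)"
    using i by (intro set_integrable_mult_right) auto
  moreover have "(\<lambda>x. indicator \<Omega> x *\<^sub>R (norm (f x \<bullet> c))\<^sup>2) = (\<lambda>x. (norm (indicator \<Omega> x *\<^sub>R (f x \<bullet> c)))\<^sup>2)"
    by (auto simp: indicator_def)
  moreover have "\<dots> \<in> borel_measurable lborel" using m' by measurable
  moreover have "(f x \<bullet> c)\<^sup>2 \<le> (norm c)\<^sup>2 * (norm (f x))\<^sup>2" for x
    using Cauchy_Schwarz_ineq[of "f x" c] by (simp add: power2_norm_eq_inner mult.commute)
  ultimately have "set_integrable lborel \<Omega> (\<lambda>x. (norm (f x \<bullet> c))\<^sup>2)"
    unfolding set_integrable_def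
    by (rule_tac Bochner_Integration.integrable_bound) (auto simp: indicator_def)
  then show ?thesis using m' by (simp add: L2_def set_borel_measurable_def)
qed

text \<open>The free parameter makes the main term cost only a factor 1 + \<eta>, while the error
  term, which will tend to 0, may carry the large factor 1 + 1 / \<eta>. This does the work of the
  triangle inequality for the L2 norm.\<close>

lemma L2_young:
  assumes "f \<in> L2 \<Omega>" "g \<in> L2 \<Omega>" "\<eta> > 0"
  shows "(LINT x:\<Omega>|lborel. (norm (f x))\<^sup>2) \<le>
    (1 + \<eta>) * (LINT x:\<Omega>|lborel. (norm (g x))\<^sup>2) + (1 + 1 / \<eta>) * (LINT x:\<Omega>|lborel. (norm (f x - g x))\<^sup>2)"
proof -
  have i: "set_integrable lborel \<Omega> (\<lambda>x. (norm (f x))\<^sup>2)" "set_integrable lborel \<Omega> (\<lambda>x. (norm (g x))\<^sup>2)"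
    "set_integrable lborel \<Omega> (\<lambda>x. (norm (f x - g x))\<^sup>2)"
    using assms L2_diff[OF assms(1,2)] by (auto simp: L2_def)
  have "(norm (f x))\<^sup>2 \<le> (1 + \<eta>) * (norm (g x))\<^sup>2 + (1 + 1 / \<eta>) * (norm (f x - g x))\<^sup>2" for x
  proof -
    let ?a = "norm (g x)" and ?b = "norm (f x - g x)"
    have "0 \<le> (\<eta> * ?a - ?b)\<^sup>2 / \<eta>" using assms by simp
    also have "\<dots> = \<eta> * ?a\<^sup>2 - 2 * ?a * ?b + ?b\<^sup>2 / \<eta>"
      using assms by (simp add: power2_eq_square field_simps)
    finally have "2 * ?a * ?b \<le> \<eta> * ?a\<^sup>2 + ?b\<^sup>2 / \<eta>" by simp
    moreover have "(norm (f x))\<^sup>2 \<le> (?a + ?b)\<^sup>2"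
      by (intro power_mono norm_triangle_sub) auto
    ultimately show ?thesis by (simp add: power2_sum algebra_simps)
  qed
  then have "(LINT x:\<Omega>|lborel. (norm (f x))\<^sup>2) \<le>
    (LINT x:\<Omega>|lborel. (1 + \<eta>) * (norm (g x))\<^sup>2 + (1 + 1 / \<eta>) * (norm (f x - g x))\<^sup>2)"
    using i by (intro set_integral_mono set_integral_add set_integrable_mult_right) auto
  also have "\<dots> = (1 + \<eta>) * (LINT x:\<Omega>|lborel. (norm (g x))\<^sup>2) + (1 + 1 / \<eta>) * (LINT x:\<Omega>|lborel. (norm (f x - g x))\<^sup>2)"
    using i by (subst set_integral_add) (auto intro!: set_integrable_mult_right)
  finally show ?thesis .
qed

lemma gradient_inner_Basis: "i \<in> Basis \<Longrightarrow> gradient f x \<bullet> i = partial f i x"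
  unfolding gradient_def by (simp add: inner_sum_left inner_Basis if_distrib cong: if_cong)

lemma test_functions_partial:
  assumes "\<phi> \<in> test_functions \<Omega>" "i \<in> Basis"
  shows "partial \<phi> i \<in> test_functions \<Omega>"
proof -
  let ?K = "closure {x. \<phi> x \<noteq> 0}"
  have "partial \<phi> i x = 0" if "x \<notin> ?K" for x
  proof -
    have "(\<phi> has_derivative (\<lambda>v. 0)) (at x)"
    proof (rule has_derivative_transform_within_open)
      show "((\<lambda>x. 0) has_derivative (\<lambda>v. 0)) (at x)" by simp
      show "0 = \<phi> y" if "y \<in> - ?K" for y
        using that closure_subset[of "{x. \<phi> x \<noteq> 0}"] by auto
    qed (use that in auto)
    then show ?thesis using frechet_derivative_at[of \<phi> "\<lambda>v. 0" x] by (simp add: fun_eq_iff)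
  qed
  then have "closure {x. partial \<phi> i x \<noteq> 0} \<subseteq> ?K"
    by (intro closure_minimal) auto
  moreover have "\<forall>n. cont_differentiable n (partial \<phi> i)"
  proof
    fix n
    have "cont_differentiable (Suc n) \<phi>" using assms(1) by (simp only: test_functions_def mem_Collect_eq)
    then show "cont_differentiable n (partial \<phi> i)" using assms(2) by simp
  qed
  moreover have "compact ?K" "?K \<subseteq> \<Omega>" using assms(1) by (auto simp: test_functions_def)
  ultimately show ?thesis
    using closed_Int_compact[OF closed_closure, of ?K "{x. partial \<phi> i x \<noteq> 0}"]
    unfolding test_functions_def by (simp add: inf.absorb1)
qed

lemma test_functions_continuous: "\<phi> \<in> test_functions \<Omega> \<Longrightarrow> continuous_on A \<phi>"
  using cont_differentiable.simps(1)[of \<phi>] continuous_on_subset[of UNIV \<phi> A]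
  by (auto simp: test_functions_def)

lemma test_functions_has_derivative:
  "\<phi> \<in> test_functions \<Omega> \<Longrightarrow> (\<phi> has_derivative frechet_derivative \<phi> (at x)) (at x)"
  using cont_differentiable.simps(2)[of 0 \<phi>] frechet_derivative_works
  by (auto simp: test_functions_def)

lemma test_functions_support: "\<phi> \<in> test_functions \<Omega> \<Longrightarrow> x \<notin> \<Omega> \<Longrightarrow> \<phi> x = 0"
  unfolding test_functions_def using closure_subset[of "{x. \<phi> x \<noteq> 0}"] by blast

lemma test_functions_partial_eq_0: 
  "\<phi> \<in> test_functions \<Omega> \<Longrightarrow> i \<in> Basis \<Longrightarrow> x \<notin> closure {x. \<phi> x \<noteq> 0} \<Longrightarrow> partial \<phi> i x = 0"
  using test_functions_support[OF test_functions_partial, of \<phi> "closure {x. \<phi> x \<noteq> 0}" i x]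
  by (auto simp: test_functions_def)

lemma gradient_continuous: "\<phi> \<in> test_functions \<Omega> \<Longrightarrow> continuous_on A (gradient \<phi>)"
  unfolding gradient_def
  by (intro continuous_intros test_functions_continuous test_functions_partial)

lemma gradient_eq_0:
  "\<phi> \<in> test_functions \<Omega> \<Longrightarrow> x \<notin> closure {x. \<phi> x \<noteq> 0} \<Longrightarrow> gradient \<phi> x = 0"
  unfolding gradient_def by (simp add: test_functions_partial_eq_0)

lemma integrable_compact_support:
  fixes F :: "'a::euclidean_space \<Rightarrow> 'b::{banach, second_countable_topology}"
  assumes "continuous_on UNIV F" "compact K" "\<And>x. x \<notin> K \<Longrightarrow> F x = 0"
  shows "integrable lborel F"
proof -
  have "(\<lambda>x. indicator K x *\<^sub>R F x) = F" using assms(3) by (auto simp: indicator_def)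
  then show ?thesis
    using borel_integrable_compact[OF assms(2), of F] assms(1) continuous_on_subset by fastforce
qed

lemma set_integral_eq_lborel:
  fixes F :: "'a::euclidean_space \<Rightarrow> 'b::{banach, second_countable_topology}"
  assumes "\<And>x. x \<notin> \<Omega> \<Longrightarrow> F x = 0"
  shows "(LINT x:\<Omega>|lborel. F x) = (LINT x|lborel. F x)"
    "set_integrable lborel \<Omega> F \<longleftrightarrow> integrable lborel F"
    "set_borel_measurable lborel \<Omega> F \<longleftrightarrow> F \<in> borel_measurable lborel"
proof -
  have "(\<lambda>x. indicator \<Omega> x *\<^sub>R F x) = F" using assms by (auto simp: indicator_def)
  then show "(LINT x:\<Omega>|lborel. F x) = (LINT x|lborel. F x)"
    "set_integrable lborel \<Omega> F \<longleftrightarrow> integrable lborel F"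
    "set_borel_measurable lborel \<Omega> F \<longleftrightarrow> F \<in> borel_measurable lborel"
    by (auto simp: set_lebesgue_integral_def set_integrable_def set_borel_measurable_def)
qed

lemma L2_compact_support:
  fixes F :: "'a::euclidean_space \<Rightarrow> 'b::euclidean_space"
  assumes F: "continuous_on UNIV F" "compact K" "\<And>x. x \<notin> K \<Longrightarrow> F x = 0" and K: "K \<subseteq> \<Omega>"
  shows "F \<in> L2 \<Omega>"
proof -
  have "integrable lborel (\<lambda>x. (norm (F x))\<^sup>2)"
    using F by (intro integrable_compact_support[of _ K] continuous_intros) auto
  moreover have "F \<in> borel_measurable lborel"
    using borel_measurable_continuous_onI[OF F(1)] by simp
  moreover have "F x = 0" if "x \<notin> \<Omega>" for x
    using F(3) K that by blast
  ultimately show ?thesis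
    by (simp add: L2_def set_integral_eq_lborel(2)[of \<Omega> "\<lambda>x. (norm (F x))\<^sup>2"] set_integral_eq_lborel(3)[of \<Omega> F])
qed

lemma test_functions_L2:
  assumes "\<phi> \<in> test_functions \<Omega>"
  shows "\<phi> \<in> L2 \<Omega>" "gradient \<phi> \<in> L2 \<Omega>"
proof -
  have K: "compact (closure {x. \<phi> x \<noteq> 0})" "closure {x. \<phi> x \<noteq> 0} \<subseteq> \<Omega>"
    using assms by (auto simp: test_functions_def)
  show "\<phi> \<in> L2 \<Omega>"
    using closure_subset[of "{x. \<phi> x \<noteq> 0}"]
    by (intro L2_compact_support[OF _ K(1) _ K(2)] test_functions_continuous[OF assms]) auto
  show "gradient \<phi> \<in> L2 \<Omega>"
    by (intro L2_compact_support[OF _ K(1) _ K(2)] gradient_continuous[OF assms] gradient_eq_0[OF assms])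
qed

lemma set_integral_sum:
  fixes f :: "'i \<Rightarrow> 'a \<Rightarrow> 'b::{banach, second_countable_topology}"
  assumes "\<And>i. i \<in> I \<Longrightarrow> set_integrable M A (f i)"
  shows "(LINT x:A|M. (\<Sum>i\<in>I. f i x)) = (\<Sum>i\<in>I. LINT x:A|M. f i x)"
  using assms unfolding set_lebesgue_integral_def set_integrable_def
  by (simp add: scaleR_sum_right Bochner_Integration.integral_sum)

text \<open>The right-hand side, an integral of \<open>u\<close> against the Laplacian of
  \<open>\<phi>\<close>, does not mention \<open>g\<close>: all weak gradients of \<open>u\<close>
  pair equally with gradients of test functions.\<close>

lemma weak_gradient_inner_gradient:
  assumes "is_weak_gradient \<Omega> u g" "g \<in> L2 \<Omega>" "\<phi> \<in> test_functions \<Omega>"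
  shows "(LINT x:\<Omega>|lborel. g x \<bullet> gradient \<phi> x) =
    - (\<Sum>i\<in>Basis. LINT x:\<Omega>|lborel. u x * partial (partial \<phi> i) i x)"
proof -
  have "(LINT x:\<Omega>|lborel. g x \<bullet> gradient \<phi> x) = (LINT x:\<Omega>|lborel. (\<Sum>i\<in>Basis. (g x \<bullet> i) * partial \<phi> i x))"
    by (simp add: gradient_def inner_sum_right mult.commute)
  also have "\<dots> = (\<Sum>i\<in>Basis. LINT x:\<Omega>|lborel. (g x \<bullet> i) * partial \<phi> i x)"
  proof (rule set_integral_sum)
    fix i :: 'a assume i: "i \<in> Basis"
    show "set_integrable lborel \<Omega> (\<lambda>x. (g x \<bullet> i) * partial \<phi> i x)"
      using L2_inner_integrable[OF L2_inner_const[OF assms(2)] test_functions_L2(1)[OF test_functions_partial[OF assms(3) i]], of i]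
      by simp
  qed
  also have "\<dots> = - (\<Sum>i\<in>Basis. LINT x:\<Omega>|lborel. u x * partial (partial \<phi> i) i x)"
    using assms(1,3) by (simp add: is_weak_gradient_def test_functions_partial sum_negf)
  finally show ?thesis .
qed

text \<open>
  Weak gradients are almost everywhere unique, but the inequality below suffices. It comes out
  directly, because the partial derivatives of the approximating test functions are themselves
  test functions and can be used in the definition of a weak gradient.
\<close>

lemma weak_gradient_norm_le:
  assumes g: "has_H1_gradient \<Omega> u g" and h: "has_H1_gradient \<Omega> u h"
    and \<phi>: "\<And>n. \<phi> n \<in> test_functions \<Omega>"
    and lim: "(\<lambda>n. LINT x:\<Omega>|lborel. (norm (gradient (\<phi> n) x - g x))\<^sup>2) \<longlonglongrightarrow> 0"
  shows "(LINT x:\<Omega>|lborel. (norm (g x))\<^sup>2) \<le> (LINT x:\<Omega>|lborel. (norm (h x))\<^sup>2)"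
proof -
  let ?v = "\<lambda>n. gradient (\<phi> n)"
  have L: "g \<in> L2 \<Omega>" "h \<in> L2 \<Omega>" "?v n \<in> L2 \<Omega>" for n
    using g h test_functions_L2(2)[OF \<phi>] by (auto simp: has_H1_gradient_def)
  note int = L2_inner_integrable[OF L(1) L(3)] L2_inner_integrable[OF L(2) L(3)]
    L[unfolded L2_def, THEN CollectD, THEN conjunct2] L2_diff[OF L(3,1), unfolded L2_def, THEN CollectD, THEN conjunct2]
  have eq: "(LINT x:\<Omega>|lborel. g x \<bullet> ?v n x) = (LINT x:\<Omega>|lborel. h x \<bullet> ?v n x)" for n
    using weak_gradient_inner_gradient[OF _ L(1) \<phi>, of u] weak_gradient_inner_gradient[OF _ L(2) \<phi>, of u] g h
    by (simp add: has_H1_gradient_def)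
  have "(LINT x:\<Omega>|lborel. (norm (g x))\<^sup>2) - (LINT x:\<Omega>|lborel. (norm (?v n x - g x))\<^sup>2)
      \<le> (LINT x:\<Omega>|lborel. (norm (h x))\<^sup>2)" for n
  proof -
    \<comment> \<open>Expanding the square leaves \<open>g\<close> only in its pairing with
      \<open>?v n\<close>, where it may be exchanged for \<open>h\<close>. What results is at most
      |h|^2 because |h - v|^2 \<ge> 0.\<close>
    have "(LINT x:\<Omega>|lborel. (norm (g x))\<^sup>2) - (LINT x:\<Omega>|lborel. (norm (?v n x - g x))\<^sup>2)
      = (LINT x:\<Omega>|lborel. (norm (g x))\<^sup>2 - (norm (?v n x - g x))\<^sup>2)"
      using int by (simp add: set_integral_diff)
    also have "\<dots> = (LINT x:\<Omega>|lborel. 2 * (g x \<bullet> ?v n x) - (norm (?v n x))\<^sup>2)"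
      by (rule arg_cong[where f = "set_lebesgue_integral lborel \<Omega>"])
        (auto simp: power2_norm_eq_inner inner_diff_left inner_diff_right inner_commute)
    also have "\<dots> = (LINT x:\<Omega>|lborel. 2 * (h x \<bullet> ?v n x) - (norm (?v n x))\<^sup>2)"
      using int by (simp add: set_integral_diff eq)
    also have "\<dots> \<le> (LINT x:\<Omega>|lborel. (norm (h x))\<^sup>2)"
    proof (rule set_integral_mono)
      show "2 * (h x \<bullet> ?v n x) - (norm (?v n x))\<^sup>2 \<le> (norm (h x))\<^sup>2" for x
        using zero_le_power2[of "norm (h x - ?v n x)"]
        unfolding power2_norm_eq_inner by (simp add: inner_diff_left inner_diff_right inner_commute)
    qed (use int in \<open>auto intro!: set_integral_diff\<close>)
    finally show ?thesis .
  qed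
  moreover have "(\<lambda>n. (LINT x:\<Omega>|lborel. (norm (g x))\<^sup>2) - (LINT x:\<Omega>|lborel. (norm (?v n x - g x))\<^sup>2))
      \<longlonglongrightarrow> (LINT x:\<Omega>|lborel. (norm (g x))\<^sup>2) - 0"
    by (intro tendsto_intros lim)
  ultimately show ?thesis
    by (intro LIMSEQ_le_const2[of _ "LINT x:\<Omega>|lborel. (norm (g x))\<^sup>2"]) auto
qed

lemma set_integral_norm_squared_nonneg: "0 \<le> (LINT x:\<Omega>|lborel. (norm (f x))\<^sup>2)"
  unfolding set_lebesgue_integral_def by (intro Bochner_Integration.integral_nonneg) auto

text \<open>Two limits in a fixed order: for given \<eta> the approximation errors vanish despite
  the factor 1 + 1 / \<eta>, then \<eta> tends to 0. This gives the bound for the gradient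
  \<open>g\<close> that the test functions approximate; \<open>weak_gradient_norm_le\<close>
  transfers it to any other gradient \<open>h\<close>.\<close>

lemma H10_poincare:
  assumes poincare: "\<And>\<phi>. \<phi> \<in> test_functions \<Omega> \<Longrightarrow>
      \<Lambda> * (LINT x:\<Omega>|lborel. (\<phi> x)\<^sup>2) \<le> (LINT x:\<Omega>|lborel. (norm (gradient \<phi> x))\<^sup>2)"
    and "\<Lambda> \<ge> 0" and u: "u \<in> H10 \<Omega>" and h: "has_H1_gradient \<Omega> u h"
  shows "\<Lambda> * (LINT x:\<Omega>|lborel. (u x)\<^sup>2) \<le> (LINT x:\<Omega>|lborel. (norm (h x))\<^sup>2)"
proof -
  obtain g \<phi> where g: "has_H1_gradient \<Omega> u g" and \<phi>: "\<And>n. \<phi> n \<in> test_functions \<Omega>"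
    and lim: "(\<lambda>n::nat. (LINT x:\<Omega>|lborel. (norm (\<phi> n x - u x))\<^sup>2) +
          (LINT x:\<Omega>|lborel. (norm (gradient (\<phi> n) x - g x))\<^sup>2)) \<longlonglongrightarrow> 0"
    using u by (auto simp: H10_def)
  let ?d = "\<lambda>n. LINT x:\<Omega>|lborel. (norm (\<phi> n x - u x))\<^sup>2"
  let ?e = "\<lambda>n. LINT x:\<Omega>|lborel. (norm (gradient (\<phi> n) x - g x))\<^sup>2"
  note nonneg = set_integral_norm_squared_nonneg
  have d: "?d \<longlonglongrightarrow> 0"
    by (rule tendsto_sandwich[OF _ _ tendsto_const lim]) (intro always_eventually allI nonneg add_increasing add_increasing2 order.refl)+
  have e: "?e \<longlonglongrightarrow> 0"
    by (rule tendsto_sandwich[OF _ _ tendsto_const lim]) (intro always_eventually allI nonneg add_increasing add_increasing2 order.refl)+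
  let ?U = "LINT x:\<Omega>|lborel. (norm (u x))\<^sup>2" and ?G = "LINT x:\<Omega>|lborel. (norm (g x))\<^sup>2"
  have L: "u \<in> L2 \<Omega>" "g \<in> L2 \<Omega>" using g by (auto simp: has_H1_gradient_def)
  have bound: "\<Lambda> * ?U \<le> (1 + \<eta>)\<^sup>2 * ?G" if "\<eta> > 0" for \<eta>
  proof -
    have "\<Lambda> * ?U \<le> (1 + \<eta>) * ((1 + \<eta>) * ?G + (1 + 1 / \<eta>) * ?e n) + \<Lambda> * ((1 + 1 / \<eta>) * ?d n)" for n
    proof -
      have "?U \<le> (1 + \<eta>) * (LINT x:\<Omega>|lborel. (norm (\<phi> n x))\<^sup>2) + (1 + 1 / \<eta>) * ?d n"
        using L2_young[OF L(1) test_functions_L2(1)[OF \<phi>] that, of n] by (simp add: norm_minus_commute power2_commute)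
      then have "\<Lambda> * ?U \<le> \<Lambda> * ((1 + \<eta>) * (LINT x:\<Omega>|lborel. (norm (\<phi> n x))\<^sup>2) + (1 + 1 / \<eta>) * ?d n)"
        by (rule mult_left_mono[OF _ assms(2)])
      also have "\<dots> = (1 + \<eta>) * (\<Lambda> * (LINT x:\<Omega>|lborel. (\<phi> n x)\<^sup>2)) + \<Lambda> * ((1 + 1 / \<eta>) * ?d n)"
        by (simp add: algebra_simps)
      also have "\<dots> \<le> (1 + \<eta>) * (LINT x:\<Omega>|lborel. (norm (gradient (\<phi> n) x))\<^sup>2) + \<Lambda> * ((1 + 1 / \<eta>) * ?d n)"
        using poincare[OF \<phi>] that by (intro add_right_mono mult_left_mono) auto
      also have "\<dots> \<le> (1 + \<eta>) * ((1 + \<eta>) * ?G + (1 + 1 / \<eta>) * ?e n) + \<Lambda> * ((1 + 1 / \<eta>) * ?d n)"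
        using L2_young[OF test_functions_L2(2)[OF \<phi>] L(2) that] that by (intro add_right_mono mult_left_mono) auto
      finally show ?thesis .
    qed
    moreover have "(\<lambda>n. (1 + \<eta>) * ((1 + \<eta>) * ?G + (1 + 1 / \<eta>) * ?e n) + \<Lambda> * ((1 + 1 / \<eta>) * ?d n))
        \<longlonglongrightarrow> (1 + \<eta>) * ((1 + \<eta>) * ?G + (1 + 1 / \<eta>) * 0) + \<Lambda> * ((1 + 1 / \<eta>) * 0)"
      by (intro tendsto_intros d e)
    ultimately have "\<Lambda> * ?U \<le> (1 + \<eta>) * ((1 + \<eta>) * ?G + (1 + 1 / \<eta>) * 0) + \<Lambda> * ((1 + 1 / \<eta>) * 0)"
      by (intro LIMSEQ_le_const) auto
    then show ?thesis by (simp add: power2_eq_square mult.assoc)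
  qed
  have "((\<lambda>\<eta>. (1 + \<eta>)\<^sup>2 * ?G) \<longlongrightarrow> (1 + 0)\<^sup>2 * ?G) (at_right 0)"
    by (intro tendsto_intros)
  then have "\<Lambda> * ?U \<le> (1 + 0)\<^sup>2 * ?G"
    by (rule tendsto_lowerbound) (use bound in \<open>auto simp: eventually_at intro!: exI[of _ 1]\<close>)
  also have "\<dots> \<le> (LINT x:\<Omega>|lborel. (norm (h x))\<^sup>2)"
    using weak_gradient_norm_le[OF g h \<phi> e] by simp
  finally show ?thesis by simp
qed

section \<open>Iterated integrals and integration by parts in the plane\<close>

lemma lborel_integral_eq_box:
  fixes F :: "'a::euclidean_space \<Rightarrow> 'b::euclidean_space"
  assumes "continuous_on UNIV F" "\<And>z. z \<notin> cbox a b \<Longrightarrow> F z = 0"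
  shows "(LINT z|lborel. F z) = integral (cbox a b) F"
proof -
  have "set_integrable lborel (cbox a b) F"
    using integrable_compact_support[OF assms(1) compact_cbox assms(2)] by (simp add: set_integral_eq_lborel assms(2))
  then show ?thesis
    using set_borel_integral_eq_integral(2) set_integral_eq_lborel(1)[of "cbox a b" F] assms(2) by metis
qed

lemma lborel_integral_eq_iterated:
  fixes F :: "real \<times> real \<Rightarrow> 'b::euclidean_space"
  assumes "continuous_on UNIV F" "\<And>z. z \<notin> cbox (a, c) (b, d) \<Longrightarrow> F z = 0"
  shows "(LINT z|lborel. F z) = integral {a..b} (\<lambda>x. integral {c..d} (\<lambda>y. F (x, y)))"
  using lborel_integral_eq_box[OF assms]
    integral_prod_continuous[of a c b d F] continuous_on_subset[OF assms(1), of "cbox (a, c) (b, d)"]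
  by simp

lemma has_field_derivative_fst_snd:
  fixes F :: "real \<times> real \<Rightarrow> real"
  assumes "(F has_derivative F') (at (x, y))"
  shows "((\<lambda>x. F (x, y)) has_field_derivative F' (1, 0)) (at x within A)"
    and "((\<lambda>y. F (x, y)) has_field_derivative F' (0, 1)) (at y within B)"
proof -
  have lin: "F' (t *\<^sub>R v) = F' v * t" for t v
    using linear_scale[OF has_derivative_linear[OF assms]] by (simp add: mult.commute)
  have lin1: "(\<lambda>h. F' (h, 0)) = (*) (F' (1, 0))"
  proof
    show "F' (h, 0) = F' (1, 0) * h" for h using lin[of h "(1, 0)"] by simp
  qed
  have lin2: "(\<lambda>h. F' (0, h)) = (*) (F' (0, 1))"
  proof
    show "F' (0, h) = F' (0, 1) * h" for h using lin[of h "(0, 1)"] by simp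
  qed
  have "((\<lambda>x. F (x, y)) has_derivative (\<lambda>h. F' (h, 0))) (at x within A)"
    by (rule has_derivative_compose[of "\<lambda>x. (x, y)" "\<lambda>h. (h, 0)", OF _ assms])
      (auto intro!: derivative_eq_intros)
  then show "((\<lambda>x. F (x, y)) has_field_derivative F' (1, 0)) (at x within A)"
    unfolding has_field_derivative_def lin1 .
  have "((\<lambda>y. F (x, y)) has_derivative (\<lambda>h. F' (0, h))) (at y within B)"
    by (rule has_derivative_compose[of "\<lambda>y. (x, y)" "\<lambda>h. (0, h)", OF _ assms])
      (auto intro!: derivative_eq_intros)
  then show "((\<lambda>y. F (x, y)) has_field_derivative F' (0, 1)) (at y within B)"
    unfolding has_field_derivative_def lin2 .
qed

lemma integral_eq_diff:
  fixes f :: "real \<Rightarrow> real"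
  assumes "a \<le> b" "\<And>x. x \<in> {a..b} \<Longrightarrow> (f has_field_derivative f' x) (at x within {a..b})"
  shows "integral {a..b} f' = f b - f a"
  using fundamental_theorem_of_calculus[of a b f f'] assms
  by (simp add: has_real_derivative_iff_has_vector_derivative integral_unique)

lemma Basis_plane: "(Basis :: (real \<times> real) set) = {(1, 0), (0, 1)}"
  by (auto simp: Basis_prod_def)

text \<open>Integrating first in the direction \<open>i\<close> leaves boundary values of
  \<open>F\<close> on a large square, and these vanish.\<close>

lemma integral_partial_eq_0:
  fixes F :: "real \<times> real \<Rightarrow> real"
  assumes F: "\<And>z. (F has_derivative F' z) (at z)" and cont: "continuous_on UNIV (\<lambda>z. F' z i)"
    and K: "compact K" "\<And>z. z \<notin> K \<Longrightarrow> F z = 0" and i: "i \<in> Basis"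
  shows "(LINT z|lborel. F' z i) = 0"
proof -
  obtain R where R: "R > 0" "\<And>z. z \<in> K \<Longrightarrow> norm z < R"
    using compact_imp_bounded[OF K(1)] bounded_pos_less by blast
  have out: "F (x, y) = 0" if "R \<le> \<bar>x\<bar> \<or> R \<le> \<bar>y\<bar>" for x y
    using that R(2)[of "(x, y)"] K(2)[of "(x, y)"] norm_fst_le[of x y] norm_snd_le[of y x] by fastforce
  have zero: "F' z i = 0" if "z \<notin> cbox (-R, -R) (R, R)" for z
  proof -
    have "(F has_derivative (\<lambda>v. 0)) (at z)"
    proof (rule has_derivative_transform_within_open)
      show "((\<lambda>x. 0) has_derivative (\<lambda>v. 0)) (at z)" by simp
      show "open (- cbox (-R, -R) (R, R))" by auto
      show "0 = F w" if "w \<in> - cbox (-R, -R) (R, R)" for w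
        using that out[of "fst w" "snd w"] by (cases w) (force simp: abs_le_iff)
    qed (use that in auto)
    then show ?thesis using has_derivative_unique[OF F, of "\<lambda>v. 0" z] by (cases i) (simp add: fun_eq_iff)
  qed
  have cont': "continuous_on A (\<lambda>z. F' z i)" for A
    using cont continuous_on_subset by blast
  consider "i = (1, 0)" | "i = (0, 1)" using i by (auto simp: Basis_plane)
  then show ?thesis
  proof cases
    case 1
    have inner: "integral {-R..R} (\<lambda>x. F' (x, y) i) = 0" for y
      unfolding 1 using R(1)
      by (subst integral_eq_diff[of "-R" R "\<lambda>x. F (x, y)"])
        (auto simp: out intro: has_field_derivative_fst_snd(1)[OF F])
    have "(LINT z|lborel. F' z i) = integral {-R..R} (\<lambda>x. integral {-R..R} (\<lambda>y. F' (x, y) i))"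
      by (rule lborel_integral_eq_iterated[OF cont zero])
    also have "\<dots> = integral {-R..R} (\<lambda>y. integral {-R..R} (\<lambda>x. F' (x, y) i))"
      using integral_swap_continuous[of "-R" "-R" R R "\<lambda>x y. F' (x, y) i"] cont' by simp
    finally show ?thesis by (simp add: inner)
  next
    case 2
    have inner: "integral {-R..R} (\<lambda>y. F' (x, y) i) = 0" for x
      unfolding 2 using R(1)
      by (subst integral_eq_diff[of "-R" R "\<lambda>y. F (x, y)"])
        (auto simp: out intro: has_field_derivative_fst_snd(2)[OF F])
    show ?thesis
      using lborel_integral_eq_iterated[OF cont zero] by (simp add: inner)
  qed
qed

lemma test_functions_compact: "\<phi> \<in> test_functions \<Omega> \<Longrightarrow> compact (closure {x. \<phi> x \<noteq> 0})"
  by (simp only: test_functions_def mem_Collect_eq)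

text \<open>The product \<open>\<phi> * \<psi>\<close> is compactly supported, so its partial
  derivative integrates to 0, and the product rule splits that integral.\<close>

lemma test_functions_is_weak_gradient:
  fixes \<Omega> :: "(real \<times> real) set"
  assumes \<phi>: "\<phi> \<in> test_functions \<Omega>"
  shows "is_weak_gradient \<Omega> \<phi> (gradient \<phi>)"
  unfolding is_weak_gradient_def
proof (intro ballI)
  fix \<psi> and i :: "real \<times> real" assume \<psi>: "\<psi> \<in> test_functions \<Omega>" and i: "i \<in> Basis"
  define K where "K = closure {x. \<phi> x \<noteq> 0}"
  have K: "compact K" unfolding K_def by (rule test_functions_compact[OF \<phi>])
  have "{x. \<phi> x \<noteq> 0} \<subseteq> K" unfolding K_def by (rule closure_subset)
  then have out: "\<phi> x = 0" "partial \<phi> i x = 0" if "x \<notin> K" for x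
    using that test_functions_partial_eq_0[OF \<phi> i, of x, folded K_def] by auto
  note cont = test_functions_continuous[OF \<phi>] test_functions_continuous[OF \<psi>]
    test_functions_continuous[OF test_functions_partial[OF \<phi> i]]
    test_functions_continuous[OF test_functions_partial[OF \<psi> i]]
  have 1: "integrable lborel (\<lambda>z. \<phi> z * partial \<psi> i z)"
    by (rule integrable_compact_support[OF continuous_on_mult K]) (use cont in \<open>simp_all add: out\<close>)
  have 2: "integrable lborel (\<lambda>z. partial \<phi> i z * \<psi> z)"
    by (rule integrable_compact_support[OF continuous_on_mult K])
      (use cont in \<open>simp_all add: out\<close>)
  have "(LINT z|lborel. \<phi> z * partial \<psi> i z + partial \<phi> i z * \<psi> z) = 0"
    by (rule integral_partial_eq_0[OF has_derivative_mult[OF test_functions_has_derivative[OF \<phi>] test_functions_has_derivative[OF \<psi>]]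
        continuous_on_add[OF continuous_on_mult continuous_on_mult] K _ i])
      (use cont in \<open>simp_all add: out\<close>)
  then have "(LINT z|lborel. \<phi> z * partial \<psi> i z) = - (LINT z|lborel. partial \<phi> i z * \<psi> z)"
    using 1 2 by simp
  moreover have "(LINT x:\<Omega>|lborel. \<phi> x * partial \<psi> i x) = (LINT z|lborel. \<phi> z * partial \<psi> i z)"
    by (rule set_integral_eq_lborel(1)) (simp add: test_functions_support[OF \<phi>])
  moreover have "(LINT x:\<Omega>|lborel. (gradient \<phi> x \<bullet> i) * \<psi> x) = (LINT z|lborel. partial \<phi> i z * \<psi> z)"
    unfolding gradient_inner_Basis[OF i]
    by (rule set_integral_eq_lborel(1)) (simp add: test_functions_support[OF \<psi>])
  ultimately show "(LINT x:\<Omega>|lborel. \<phi> x * partial \<psi> i x) = - (LINT x:\<Omega>|lborel. (gradient \<phi> x \<bullet> i) * \<psi> x)"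
    by simp
qed

lemma test_functions_H10:
  fixes \<Omega> :: "(real \<times> real) set"
  assumes \<phi>: "\<phi> \<in> test_functions \<Omega>"
  shows "has_H1_gradient \<Omega> \<phi> (gradient \<phi>)" "\<phi> \<in> H10 \<Omega>"
proof -
  show *: "has_H1_gradient \<Omega> \<phi> (gradient \<phi>)"
    unfolding has_H1_gradient_def
    by (intro conjI test_functions_is_weak_gradient[OF \<phi>] test_functions_L2[OF \<phi>])
  show "\<phi> \<in> H10 \<Omega>"
    unfolding H10_def
    by (rule CollectI, rule exI[of _ "gradient \<phi>"], rule conjI[OF *], rule exI[of _ "\<lambda>_. \<phi>"]) (simp add: \<phi>)
qed

section \<open>The first eigenvalue\<close>

lemma continuous_AE_eq_0:
  fixes f :: "'a::euclidean_space \<Rightarrow> real"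
  assumes "continuous_on UNIV f" "AE x in lborel. f x = 0"
  shows "f x = 0"
proof (rule ccontr)
  assume *: "f x \<noteq> 0"
  have op: "open {x. f x \<noteq> 0}"
    using open_Collect_neq[OF assms(1) continuous_on_const[of UNIV 0]] .
  then have "{x. f x \<noteq> 0} \<in> null_sets lborel"
    using assms(2) AE_iff_null_sets[of "{x. f x \<noteq> 0}" lborel] by simp
  then have "negligible {x. f x \<noteq> 0}"
    by (simp add: negligible_iff_null_sets null_sets_completionI)
  then show False using open_not_negligible[OF op] * by blast
qed

lemma set_integral_square_pos:
  fixes u :: "'a::euclidean_space \<Rightarrow> real"
  assumes "u \<in> L2 \<Omega>" "\<not> (AE x in lborel. x \<in> \<Omega> \<longrightarrow> u x = 0)"
  shows "0 < (LINT x:\<Omega>|lborel. (u x)\<^sup>2)"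
proof -
  have "integrable lborel (\<lambda>x. indicator \<Omega> x *\<^sub>R (u x)\<^sup>2)"
    using assms(1) by (simp add: L2_def set_integrable_def)
  from integral_nonneg_eq_0_iff_AE[OF this] have "(LINT x:\<Omega>|lborel. (u x)\<^sup>2) \<noteq> 0"
    using assms(2) by (auto simp: set_lebesgue_integral_def indicator_def)
  moreover have "0 \<le> (LINT x:\<Omega>|lborel. (u x)\<^sup>2)"
    using set_integral_norm_squared_nonneg[of \<Omega> u] by simp
  ultimately show ?thesis by simp
qed

text \<open>A bump built from r^2 - |x - p|^2 suffices. It ensures that the set of Rayleigh
  quotients is nonempty, without which a lower bound on the real-valued \<open>Inf\<close> could not
  be derived.\<close>

lemma exists_test_function:
  fixes \<Omega> :: "'a::euclidean_space set"
  assumes "open \<Omega>" "p \<in> \<Omega>"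
  shows "\<exists>\<phi>\<in>test_functions \<Omega>. \<phi> p \<noteq> 0"
proof -
  obtain r where r: "r > 0" "cball p r \<subseteq> \<Omega>"
    using assms open_contains_cball by blast
  let ?h = "\<lambda>x. r\<^sup>2 + (- 1) * ((x - p) \<bullet> (x - p))"
  let ?\<phi> = "\<lambda>x. flat_function 1 1 (?h x)"
  have "smooth ?\<phi>"
    using smooth_flat_cutoff[of 1 UNIV ?h 1] smooth_dist_squared[of "r\<^sup>2" "- 1" p] by simp
  moreover have "closure {x. ?\<phi> x \<noteq> 0} \<subseteq> cball p r"
  proof (rule closure_minimal)
    have "dist p x \<le> r" if "?\<phi> x \<noteq> 0" for x
    proof -
      have "?h x > 0" using that flat_function_1(4,5)[of 1 "?h x"] by simp
      then have "(norm (x - p))\<^sup>2 < r\<^sup>2" by (simp add: power2_norm_eq_inner)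
      then show ?thesis using r(1) by (simp add: dist_norm norm_minus_commute power_less_imp_less_base)
        (meson less_imp_le power2_less_imp_less)
    qed
    then show "{x. ?\<phi> x \<noteq> 0} \<subseteq> cball p r" by auto
  qed auto
  moreover from this have "bounded {x. ?\<phi> x \<noteq> 0}"
    using bounded_subset[OF bounded_cball] closure_subset by blast
  ultimately have "?\<phi> \<in> test_functions \<Omega>"
    using r(2) by (auto simp: test_functions_def smooth_def)
  moreover have "?\<phi> p \<noteq> 0" using flat_function_1(5)[of 1 "?h p"] r(1) by simp
  ultimately show ?thesis by (intro bexI[of _ ?\<phi>])
qed

lemma test_function_not_AE_zero:
  assumes "\<phi> \<in> test_functions \<Omega>" "\<phi> p \<noteq> 0"
  shows "\<not> (AE x in lborel. x \<in> \<Omega> \<longrightarrow> \<phi> x = 0)"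
proof
  assume "AE x in lborel. x \<in> \<Omega> \<longrightarrow> \<phi> x = 0"
  then have "AE x in lborel. \<phi> x = 0"
    by eventually_elim (use test_functions_support[OF assms(1)] in auto)
  then show False
    using continuous_AE_eq_0[OF test_functions_continuous[OF assms(1)], of p] assms(2) by simp
qed

lemma lambda1_le:
  fixes \<Omega> :: "(real \<times> real) set"
  assumes "\<phi> \<in> test_functions \<Omega>" "\<phi> p \<noteq> 0"
  shows "lambda1 \<Omega> \<le> (LINT x:\<Omega>|lborel. (norm (gradient \<phi> x))\<^sup>2) / (LINT x:\<Omega>|lborel. (\<phi> x)\<^sup>2)"
  unfolding lambda1_def
proof (rule cInf_lower)
  show "(LINT x:\<Omega>|lborel. (norm (gradient \<phi> x))\<^sup>2) / (LINT x:\<Omega>|lborel. (\<phi> x)\<^sup>2)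
    \<in> {(LINT x:\<Omega>|lborel. (norm (g x))\<^sup>2) / (LINT x:\<Omega>|lborel. (u x)\<^sup>2) | u g.
     u \<in> H10 \<Omega> \<and> has_H1_gradient \<Omega> u g \<and> \<not> (AE x in lborel. x \<in> \<Omega> \<longrightarrow> u x = 0)}"
    using test_functions_H10[OF assms(1)] test_function_not_AE_zero[OF assms] by blast
  show "bdd_below {(LINT x:\<Omega>|lborel. (norm (g x))\<^sup>2) / (LINT x:\<Omega>|lborel. (u x)\<^sup>2) | u g.
     u \<in> H10 \<Omega> \<and> has_H1_gradient \<Omega> u g \<and> \<not> (AE x in lborel. x \<in> \<Omega> \<longrightarrow> u x = 0)}"
  proof (rule bdd_belowI[of _ 0], safe)
    fix u g
    show "0 \<le> (LINT x:\<Omega>|lborel. (norm (g x))\<^sup>2) / (LINT x:\<Omega>|lborel. (u x)\<^sup>2)"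
      using set_integral_norm_squared_nonneg[of \<Omega> g] set_integral_norm_squared_nonneg[of \<Omega> u] by simp
  qed
qed

lemma lambda1_ge:
  fixes \<Omega> :: "(real \<times> real) set"
  assumes "open \<Omega>" "\<Omega> \<noteq> {}" "\<Lambda> \<ge> 0"
    and poincare: "\<And>\<phi>. \<phi> \<in> test_functions \<Omega> \<Longrightarrow>
      \<Lambda> * (LINT x:\<Omega>|lborel. (\<phi> x)\<^sup>2) \<le> (LINT x:\<Omega>|lborel. (norm (gradient \<phi> x))\<^sup>2)"
  shows "\<Lambda> \<le> lambda1 \<Omega>"
  unfolding lambda1_def
proof (rule cInf_greatest)
  obtain \<phi> p where \<phi>: "\<phi> \<in> test_functions \<Omega>" "\<phi> p \<noteq> 0"
    using exists_test_function[OF assms(1)] assms(2) by blast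
  show "{(LINT x:\<Omega>|lborel. (norm (g x))\<^sup>2) / (LINT x:\<Omega>|lborel. (u x)\<^sup>2) | u g.
     u \<in> H10 \<Omega> \<and> has_H1_gradient \<Omega> u g \<and> \<not> (AE x in lborel. x \<in> \<Omega> \<longrightarrow> u x = 0)} \<noteq> {}"
    using test_functions_H10[OF \<phi>(1)] test_function_not_AE_zero[OF \<phi>] by blast
next
  fix q assume "q \<in> {(LINT x:\<Omega>|lborel. (norm (g x))\<^sup>2) / (LINT x:\<Omega>|lborel. (u x)\<^sup>2) | u g.
     u \<in> H10 \<Omega> \<and> has_H1_gradient \<Omega> u g \<and> \<not> (AE x in lborel. x \<in> \<Omega> \<longrightarrow> u x = 0)}"
  then obtain u g where q: "q = (LINT x:\<Omega>|lborel. (norm (g x))\<^sup>2) / (LINT x:\<Omega>|lborel. (u x)\<^sup>2)"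
    and u: "u \<in> H10 \<Omega>" "has_H1_gradient \<Omega> u g" "\<not> (AE x in lborel. x \<in> \<Omega> \<longrightarrow> u x = 0)"
    by blast
  have "0 < (LINT x:\<Omega>|lborel. (u x)\<^sup>2)"
    using u by (intro set_integral_square_pos) (auto simp: has_H1_gradient_def)
  then show "\<Lambda> \<le> q"
    using H10_poincare[OF poincare assms(3) u(1,2)] by (simp add: q field_simps)
qed

section \<open>The Faber--Krahn inequality on the line\<close>

text \<open>Around a point of the open set \<open>U\<close> the measure to the left grows at unit
  speed. Moving a little to either side gives the strict bounds, which later keep the argument of
  the sine strictly between 0 and pi.\<close>

lemma measure_less_has_derivative:
  fixes U :: "real set"
  assumes "open U" "emeasure lborel U < \<infinity>" "y \<in> U"
  defines "s \<equiv> \<lambda>y. measure lborel (U \<inter> {..<y})"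
  shows "(s has_field_derivative 1) (at y)" "0 < s y" "s y < measure lborel U"
proof -
  have fin: "emeasure lborel (U \<inter> V) \<noteq> \<infinity>" for V
    using assms(2) emeasure_mono[of "U \<inter> V" U lborel] assms(1) by (auto simp: top_unique)
  have step: "s v = s u + (v - u)" if "u \<le> v" "{u..<v} \<subseteq> U" for u v
  proof -
    have "U \<inter> {..<v} = (U \<inter> {..<u}) \<union> {u..<v}" using that by auto
    moreover have "measure lborel ((U \<inter> {..<u}) \<union> {u..<v}) = measure lborel (U \<inter> {..<u}) + measure lborel {u..<v}"
      using fin that assms(1) by (intro measure_Union) auto
    ultimately show ?thesis using that by (simp add: s_def)
  qed
  obtain e where e: "e > 0" "ball y e \<subseteq> U"
    using assms(1,3) open_contains_ball by blast
  have near: "s z = s y + (z - y)" if "z \<in> ball y e" for z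
  proof (cases "y \<le> z")
    case True
    then have "{y..<z} \<subseteq> ball y e" using that by (auto simp: dist_real_def)
    then show ?thesis using step[OF True] e(2) by blast
  next
    case False
    then have "{z..<y} \<subseteq> ball y e" using that by (auto simp: dist_real_def)
    then show ?thesis using step[of z y] False e(2) by force
  qed
  have "((\<lambda>z. s y + (z - y)) has_field_derivative 1) (at y)"
    by (auto intro!: derivative_eq_intros)
  then show "(s has_field_derivative 1) (at y)"
    by (rule has_field_derivative_transform_within_open[where S = "ball y e"]) (use e near[symmetric] in auto)
  have "s (y - e / 2) = s y - e / 2" using near[of "y - e / 2"] e(1) by (simp add: dist_real_def)
  then show "0 < s y" using e(1) measure_nonneg[of lborel "U \<inter> {..<y - e / 2}"] by (simp add: s_def)
  have "s (y + e / 2) = s y + e / 2" using near[of "y + e / 2"] e(1) by (simp add: dist_real_def)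
  moreover have "s (y + e / 2) \<le> measure lborel U"
    unfolding s_def using fin[of UNIV] assms(1) by (intro measure_mono_fmeasurable) (auto simp: fmeasurable_def top.not_eq_extremum)
  ultimately show "s y < measure lborel U" using e(1) by simp
qed

text \<open>
  With \<open>s(y) = |U \<inter> (-\<infinity>, y)|\<close>, the function \<open>C = (\<pi> / l) cot (\<pi> s / l)\<close> solves the Riccati equation
  \<open>C' = - C\<^sup>2 - (\<pi> / l)\<^sup>2\<close> on \<open>U\<close>, and \<open>(g' - C g)\<^sup>2 \<ge> 0\<close> integrates to the claim. Measuring position
  by \<open>s\<close> makes it unnecessary to treat the components of \<open>U\<close> separately.
\<close>

lemma faber_krahn_real:
  fixes g g' :: "real \<Rightarrow> real"
  assumes U: "open U" "U \<subseteq> {0<..<b}" and K: "compact K" "K \<subseteq> U" "\<And>y. y \<notin> K \<Longrightarrow> g y = 0"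
    and g: "\<And>y. (g has_field_derivative g' y) (at y)" "continuous_on UNIV g'"
  shows "(pi / measure lborel U)\<^sup>2 * integral {0..b} (\<lambda>y. (g y)\<^sup>2) \<le> integral {0..b} (\<lambda>y. (g' y)\<^sup>2)"
proof (cases "U = {}")
  case True
  then have "g y = 0" for y using K by auto
  moreover have "(\<lambda>y. (g' y)\<^sup>2) integrable_on {0..b}"
    using g(2) by (intro integrable_continuous_real continuous_intros) (auto intro: continuous_on_subset)
  ultimately show ?thesis by (simp add: integral_nonneg)
next
  case False
  define l where "l = measure lborel U"
  define s where "s y = measure lborel (U \<inter> {..<y})" for y
  have "emeasure lborel U \<le> emeasure lborel {0<..<b}" using U by (intro emeasure_mono) auto
  then have fin: "emeasure lborel U < \<infinity>" by (cases "0 \<le> b") (auto intro: le_less_trans)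
  note s = measure_less_has_derivative[OF U(1) fin, folded s_def l_def]
  have b: "0 < b" using False U by auto
  obtain y0 where "y0 \<in> U" using False by blast
  then have l: "l > 0" using s(2,3)[of y0] by simp
  define C where "C y = (pi / l) * (cos (pi * s y / l) / sin (pi * s y / l))" for y
  have C: "(C has_field_derivative - ((C y)\<^sup>2 + (pi / l)\<^sup>2)) (at y)" if "y \<in> U" for y
  proof -
    have pos: "sin (pi * s y / l) > 0"
      using s(2,3)[OF that] l by (intro sin_gt_zero) (auto simp: field_simps)
    have cot: "(p * (c / d))\<^sup>2 + p\<^sup>2 = p\<^sup>2 / d\<^sup>2" if "d > 0" "d\<^sup>2 + c\<^sup>2 = 1" for p c d :: real
    proof -
      have "(p * (c / d))\<^sup>2 + p\<^sup>2 = p\<^sup>2 * (d\<^sup>2 + c\<^sup>2) / d\<^sup>2"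
        using that(1) by (simp add: power_mult_distrib power_divide field_simps)
      then show ?thesis using that(2) by simp
    qed
    have eq: "(C y)\<^sup>2 + (pi / l)\<^sup>2 = (pi / l)\<^sup>2 / (sin (pi * s y / l))\<^sup>2"
      unfolding C_def by (rule cot[OF pos]) simp
    have "((\<lambda>y. cos (pi * s y / l) / sin (pi * s y / l)) has_field_derivative
        - (pi / l) * ((sin (pi * s y / l))\<^sup>2 + (cos (pi * s y / l))\<^sup>2) / (sin (pi * s y / l))\<^sup>2) (at y)"
      using pos by (auto intro!: derivative_eq_intros s(1)[OF that] simp: power2_eq_square field_simps
          simp del: sin_cos_squared_add sin_cos_squared_add2 sin_cos_squared_add3)
    from DERIV_cmult[OF this, of "pi / l"]
    have "(C has_field_derivative - ((pi / l)\<^sup>2 / (sin (pi * s y / l))\<^sup>2)) (at y)"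
      unfolding C_def by (rule DERIV_cong) (simp only: sin_cos_squared_add, simp add: power2_eq_square mult.assoc)
    then show ?thesis unfolding eq[symmetric] by simp
  qed
  \<comment> \<open>\<open>C\<close> blows up at the ends of the components of \<open>U\<close>, but
    \<open>g\<close> vanishes off the compact \<open>K\<close> inside \<open>U\<close>. Hence the
    zero extension of g^2 C vanishes near every point outside \<open>U\<close>, is differentiable
    everywhere, and its derivative integrates to 0.\<close>
  define k where "k y = (if y \<in> U then (g y)\<^sup>2 * C y else 0)" for y
  define k' where "k' y = (if y \<in> U then 2 * g y * g' y * C y - (g y)\<^sup>2 * ((C y)\<^sup>2 + (pi / l)\<^sup>2) else 0)" for y
  have "(k has_field_derivative k' y) (at y)" for y
  proof (cases "y \<in> U")
    case True
    have "((\<lambda>y. (g y)\<^sup>2 * C y) has_field_derivative k' y) (at y)"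
      using True by (auto intro!: derivative_eq_intros g C simp: k'_def algebra_simps)
    then show ?thesis
      by (rule has_field_derivative_transform_within_open[OF _ U(1) True]) (simp add: k_def)
  next
    case False
    have "((\<lambda>y. 0) has_field_derivative 0) (at y)" by simp
    then have "(k has_field_derivative 0) (at y)"
      by (rule has_field_derivative_transform_within_open[where S = "- K"])
        (use K False in \<open>auto simp: k_def compact_imp_closed open_Compl\<close>)
    then show ?thesis using False by (simp add: k'_def)
  qed
  then have "(k' has_integral k b - k 0) {0..b}"
    using b by (intro fundamental_theorem_of_calculus)
      (auto simp flip: has_real_derivative_iff_has_vector_derivative intro: has_field_derivative_at_within)
  moreover have "k b = 0" "k 0 = 0" using U(2) by (auto simp: k_def)
  ultimately have int_k': "(k' has_integral 0) {0..b}" by simp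
  have cont: "continuous_on A g" "continuous_on A g'" for A
    using DERIV_continuous_on[of A g g'] has_field_derivative_at_within[OF g(1)] continuous_on_subset[OF g(2)] by auto
  have int: "(\<lambda>y. (g y)\<^sup>2) integrable_on {0..b}" "(\<lambda>y. (g' y)\<^sup>2) integrable_on {0..b}"
    by (intro integrable_continuous_real continuous_intros cont)+
  have "((\<lambda>y. (g' y)\<^sup>2 - (pi / l)\<^sup>2 * (g y)\<^sup>2) has_integral
      integral {0..b} (\<lambda>y. (g' y)\<^sup>2) - (pi / l)\<^sup>2 * integral {0..b} (\<lambda>y. (g y)\<^sup>2)) {0..b}"
    using int by (intro has_integral_diff has_integral_mult_right integrable_integral)
  note int_diff = this
  have le: "k' y \<le> (g' y)\<^sup>2 - (pi / l)\<^sup>2 * (g y)\<^sup>2" for y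
  proof (cases "y \<in> U")
    case True
    then show ?thesis
      using zero_le_power2[of "g' y - C y * g y"] by (simp add: k'_def power2_eq_square algebra_simps)
  next
    case False
    then have "g y = 0" using K(2,3) by blast
    then show ?thesis using False by (simp add: k'_def)
  qed
  show ?thesis
    using has_integral_le[OF int_k' int_diff le] by (simp add: l_def)
qed

section \<open>Lower bound for domains in a strip\<close>

text \<open>Tonelli's theorem in \<open>ennreal\<close>. The strip bounds every slice, so the
  real-valued \<open>measure\<close> agrees with \<open>emeasure\<close> and its default value 0 for
  infinite sets never occurs.\<close>

lemma integral_slice_measure:
  fixes \<Omega> :: "(real \<times> real) set"
  assumes "open \<Omega>" "\<Omega> \<subseteq> UNIV \<times> {0<..<b}" "emeasure lborel \<Omega> \<le> ennreal c" "0 \<le> c"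
  shows "integrable lborel (\<lambda>x. measure lborel (Pair x -` \<Omega>))"
    and "(LINT x|lborel. measure lborel (Pair x -` \<Omega>)) \<le> c"
proof -
  have sets: "\<Omega> \<in> sets (lborel \<Otimes>\<^sub>M lborel)"
    unfolding lborel_prod using assms(1) by simp
  have "emeasure lborel (Pair x -` \<Omega>) \<noteq> \<infinity>" for x
  proof -
    have "emeasure lborel (Pair x -` \<Omega>) \<le> emeasure lborel {0<..<b}"
      using assms(2) by (intro emeasure_mono) auto
    then show ?thesis by (cases "0 \<le> b") (auto simp: top_unique)
  qed
  then have em: "emeasure lborel (Pair x -` \<Omega>) = ennreal (measure lborel (Pair x -` \<Omega>))" for x
    by (simp add: emeasure_eq_ennreal_measure)
  have "(\<lambda>x. emeasure lborel (Pair x -` \<Omega>)) \<in> borel_measurable lborel"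
    by (rule lborel.measurable_emeasure_Pair[OF sets])
  then have "(\<lambda>x. enn2real (emeasure lborel (Pair x -` \<Omega>))) \<in> borel_measurable lborel"
    by measurable
  then have meas: "(\<lambda>x. measure lborel (Pair x -` \<Omega>)) \<in> borel_measurable lborel"
    by (simp add: measure_def)
  have le: "(\<integral>\<^sup>+x. ennreal (measure lborel (Pair x -` \<Omega>)) \<partial>lborel) \<le> ennreal c"
    using assms(3) lborel.emeasure_pair_measure_alt[OF sets] unfolding lborel_prod em by simp
  then show int: "integrable lborel (\<lambda>x. measure lborel (Pair x -` \<Omega>))"
    using meas by (intro integrableI_bounded) (auto intro: le_less_trans)
  show "(LINT x|lborel. measure lborel (Pair x -` \<Omega>)) \<le> c"
    using le nn_integral_eq_integral[OF int] assms(4) by simp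
qed

text \<open>The difference of the two sides is affine in \<open>m\<close>, so it is a convex
  combination of its values at m = 1 and m = 0. At m = 1 it is nonnegative because (t - 1/2)^2 (2 -
  t) \<ge> 0 says exactly (3/2 - t)^2 t \<le> 1/2; at m = 0 it needs H \<ge> 9/4 + 3/2, which 4
  exceeds. In use, \<open>t\<close> is \<open>w\<close> divided by its maximum.\<close>

lemma obstacle_inequality:
  fixes t m H :: real
  assumes "0 \<le> t" "t \<le> 1" "0 \<le> m" "m \<le> 1" "H \<ge> 4"
  shows "3 / 2 * t \<le> H * (1 - m) * t + 2 * m - (3 / 2 - t)\<^sup>2 * t"
proof -
  have "0 \<le> (t - 1 / 2)\<^sup>2 * (2 - t)" using assms by simp
  then have "(3 / 2 - t)\<^sup>2 * t \<le> 1 / 2"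
    by (simp add: power2_eq_square field_simps)
  then have 1: "0 \<le> 2 - (3 / 2 - t)\<^sup>2 * t - 3 / 2 * t"
    using assms(2) by simp
  have "(3 / 2 - t)\<^sup>2 \<le> (3 / 2)\<^sup>2" using assms by (intro power_mono) auto
  then have "(3 / 2 - t)\<^sup>2 \<le> 9 / 4" by (simp add: power_divide)
  then have 2: "0 \<le> (H - (3 / 2 - t)\<^sup>2 - 3 / 2) * t"
    using assms by (intro mult_nonneg_nonneg) auto
  have "0 \<le> m * (2 - (3 / 2 - t)\<^sup>2 * t - 3 / 2 * t) + (1 - m) * ((H - (3 / 2 - t)\<^sup>2 - 3 / 2) * t)"
    using assms by (intro add_nonneg_nonneg mult_nonneg_nonneg[OF _ 1] mult_nonneg_nonneg[OF _ 2]) auto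
  then show ?thesis by (simp add: algebra_simps add_divide_distrib diff_divide_distrib)
qed

text \<open>
  Here \<open>w\<close> stands for the square of a function \<open>v\<close>, and the hypothesis on \<open>q\<close> for \<open>q \<ge> v'\<^sup>2\<close>.
  Applying it with \<open>p = \<plusminus> (3/2 - w / max w)\<close>, the sign changing at the maximum of \<open>w\<close>, turns
  \<open>p w'\<close> into a derivative, whose integral \<open>2 max w\<close> pays for the region where \<open>m\<close> is large.
\<close>

lemma one_dimensional_bound:
  fixes w w' q r m :: "real \<Rightarrow> real"
  assumes w: "\<And>x. (w has_field_derivative w' x) (at x)" "\<And>x. 0 \<le> w x" "w (-R) = 0" "w R = 0" and "R > 0"
    and cont: "continuous_on UNIV q" "continuous_on UNIV r"
    and q: "\<And>x p. p * w' x - p\<^sup>2 * w x \<le> q x"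
    and r: "\<And>x. H * (1 - m x) * w x \<le> r x"
    and m: "\<And>x. 0 \<le> m x" "\<And>x. m x \<le> 1" "integrable lborel m" "(LINT x|lborel. m x) \<le> 1" and H: "H \<ge> 4"
  shows "3 / 2 * integral {-R..R} w \<le> integral {-R..R} (\<lambda>x. q x + r x)"
proof -
  have cont_w: "continuous_on A w" for A
    using DERIV_continuous_on[of A w w'] has_field_derivative_at_within[OF w(1)] by blast
  note cont' = cont[THEN continuous_on_subset, OF subset_UNIV] cont_w
  obtain x0 where x0: "x0 \<in> {-R..R}" "\<And>x. x \<in> {-R..R} \<Longrightarrow> w x \<le> w x0"
    using continuous_attains_sup[of "{-R..R}" w] cont_w \<open>R > 0\<close> by auto
  define M where "M = w x0"
  show ?thesis
  proof (cases "M = 0")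
    case True
    have "integral {-R..R} w = integral {-R..R} (\<lambda>x. 0)"
      using x0 w(2) True by (intro integral_cong) (auto simp: M_def intro: antisym)
    moreover have "0 \<le> q x + r x" if "x \<in> {-R..R}" for x
    proof -
      have "w x = 0" using x0(2)[OF that] w(2)[of x] True by (simp add: M_def)
      then show ?thesis using q[of 0 x] r[of x] by simp
    qed
    then have "0 \<le> integral {-R..R} (\<lambda>x. q x + r x)"
      by (intro integral_nonneg integrable_continuous_real continuous_intros cont')
    ultimately show ?thesis by simp
  next
    case False
    then have M: "M > 0" using w(2)[of x0] by (simp add: M_def)
    \<comment> \<open>An antiderivative of (3/2 - w / M) w'. The offset 3/2 is the one for which 3/2
      - t has integral 1 over [0, 1], so \<open>F\<close> climbs from 0 to exactly \<open>M\<close>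
      at the maximum. The two halves together yield 2 M, which is the most that the term
      \<open>2 * M * m x\<close> can cost, as \<open>m\<close> has integral at most 1.\<close>
    define F where "F x = 3 / 2 * w x - (w x)\<^sup>2 / (2 * M)" for x
    have F: "(F has_field_derivative (3 / 2 - w x / M) * w' x) (at x within A)" for x A
      unfolding F_def using M
      by (auto intro!: derivative_eq_intros has_field_derivative_at_within[OF w(1)] simp: field_simps power2_eq_square)
    have F_ends: "F (-R) = 0" "F R = 0" "F x0 = M"
      using w M by (auto simp: F_def M_def power2_eq_square)
    let ?G = "\<lambda>x. q x + r x - 3 / 2 * w x"
    have pointwise: "s * ((3 / 2 - w x / M) * w' x) - 2 * M * m x \<le> ?G x" if "x \<in> {-R..R}" "s\<^sup>2 = 1" for s x
    proof -
      have t: "0 \<le> w x / M" "w x / M \<le> 1" using w(2)[of x] x0(2)[OF that(1)] M by (auto simp: M_def)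
      have "3 / 2 * w x = M * (3 / 2 * (w x / M))" using M by simp
      also have "\<dots> \<le> M * (H * (1 - m x) * (w x / M) + 2 * m x - (3 / 2 - w x / M)\<^sup>2 * (w x / M))"
        using obstacle_inequality[OF t m(1,2) H] M by (intro mult_left_mono) auto
      also have "\<dots> = H * (1 - m x) * w x + 2 * M * m x - (3 / 2 - w x / M)\<^sup>2 * w x"
        using M by (simp add: algebra_simps)
      finally have "3 / 2 * w x \<le> \<dots>" .
      moreover have "(s * (3 / 2 - w x / M))\<^sup>2 = (3 / 2 - w x / M)\<^sup>2" using that(2) by (simp add: power_mult_distrib)
      ultimately show ?thesis
        using q[of "s * (3 / 2 - w x / M)" x] r[of x] by (simp add: mult.assoc)
    qed
    have m_int: "m integrable_on {a..b}" for a b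
      using set_borel_integral_eq_integral(1)[of "{a..b}" m] integrable_mult_indicator[of "{a..b}" lborel m] m(3)
      by (simp add: set_integrable_def)
    have G_int: "?G integrable_on {a..b}" for a b
      by (intro integrable_continuous_real continuous_intros cont')
    have half: "s * (F b - F a) - 2 * M * integral {a..b} m \<le> integral {a..b} ?G"
      if "a \<le> b" "{a..b} \<subseteq> {-R..R}" "s\<^sup>2 = 1" for a b s
    proof -
      have "((\<lambda>x. (3 / 2 - w x / M) * w' x) has_integral F b - F a) {a..b}"
        using that(1) F by (intro fundamental_theorem_of_calculus)
          (auto simp flip: has_real_derivative_iff_has_vector_derivative)
      then have "((\<lambda>x. s * ((3 / 2 - w x / M) * w' x) - 2 * M * m x) has_integral
          s * (F b - F a) - 2 * M * integral {a..b} m) {a..b}"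
        using m_int by (intro has_integral_diff has_integral_mult_right integrable_integral)
      from has_integral_le[OF this integrable_integral[OF G_int]] show ?thesis
        using pointwise that by blast
    qed
    note combine = Henstock_Kurzweil_Integration.integral_combine[symmetric, of "-R" x0 R]
    have "2 * M - 2 * M * integral {-R..R} m \<le> integral {-R..R} ?G"
    proof -
      have "integral {-R..R} ?G = integral {-R..x0} ?G + integral {x0..R} ?G"
        "integral {-R..R} m = integral {-R..x0} m + integral {x0..R} m"
        by (rule combine[OF _ _ G_int]; use x0(1) in simp) (rule combine[OF _ _ m_int]; use x0(1) in simp)
      then show ?thesis
        using half[of "-R" x0 1] half[of x0 R "-1"] x0(1) F_ends by (simp add: distrib_left)
    qed
    moreover have "integral {-R..R} m \<le> 1"
    proof -
      have "integral {-R..R} m \<le> integral UNIV m"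
        using has_integral_integral_lborel[OF m(3)] m(1) m_int
        by (intro integral_subset_le) (auto simp: has_integral_integrable)
      also have "\<dots> \<le> 1" using has_integral_integral_lborel[OF m(3)] m(4) by (simp add: integral_unique)
      finally show ?thesis .
    qed
    then have "2 * M * integral {-R..R} m \<le> 2 * M * 1" using M by (intro mult_left_mono) auto
    ultimately have "0 \<le> integral {-R..R} ?G" by simp
    also have "\<dots> = integral {-R..R} (\<lambda>x. q x + r x) - 3 / 2 * integral {-R..R} w"
      by (subst integral_diff) (auto intro!: integrable_continuous_real continuous_intros cont')
    finally show ?thesis by simp
  qed
qed

lemma norm_gradient_plane:
  fixes f :: "real \<times> real \<Rightarrow> real"
  shows "(norm (gradient f z))\<^sup>2 = (partial f (1, 0) z)\<^sup>2 + (partial f (0, 1) z)\<^sup>2"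
  unfolding gradient_def Basis_plane by (simp add: norm_Pair)

lemma integral_param_continuous:
  fixes f :: "real \<times> real \<Rightarrow> real"
  assumes "continuous_on UNIV f"
  shows "continuous_on UNIV (\<lambda>x. integral {a..b} (\<lambda>y. f (x, y)))"
  using integral_continuous_on_param[of UNIV a b "\<lambda>x y. f (x, y)"] continuous_on_subset[OF assms]
  by (simp add: case_prod_unfold)

text \<open>With m = l / b this is the tangent 3 - 2 m to the convex function m^(-2) at m = 1; the
  gap is (1 - m)^2 (1 + 2 m) \<ge> 0 after multiplication by m^2.\<close>

lemma inverse_square_tangent:
  fixes l b :: real
  assumes "0 < l" "l \<le> b"
  shows "(pi / b)\<^sup>2 + 2 * (pi / b)\<^sup>2 * (1 - l / b) \<le> (pi / l)\<^sup>2"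
proof -
  define m where "m = l / b"
  have m: "0 < m" "m \<le> 1" "l = m * b" using assms by (auto simp: m_def)
  have "0 \<le> (1 - m)\<^sup>2 * (1 + 2 * m)" using m by simp
  then have "(3 - 2 * m) * m\<^sup>2 \<le> 1" by (simp add: power2_eq_square algebra_simps)
  then have "3 - 2 * m \<le> 1 / m\<^sup>2" using m by (simp add: pos_le_divide_eq)
  then have "(pi / b)\<^sup>2 * (3 - 2 * m) \<le> (pi / b)\<^sup>2 * (1 / m\<^sup>2)" by (rule mult_left_mono) simp
  also have "\<dots> = (pi / l)\<^sup>2" using m by (simp add: power_mult_distrib power_divide)
  finally show ?thesis by (simp add: m_def[symmetric] algebra_simps)
qed

text \<open>Slicing reduces the claim to \<open>one_dimensional_bound\<close>, with \<open>q\<close>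
  and \<open>r\<close> the slice integrals of the two squared partial derivatives. The transverse
  ground energy (pi / b)^2 w is removed from \<open>r\<close>, and what the shorter slices add to it
  acts as a potential of strength 2 (pi / b)^2.\<close>

lemma strip_poincare:
  fixes \<Omega> :: "(real \<times> real) set"
  assumes \<Omega>: "open \<Omega>" "\<Omega> \<subseteq> UNIV \<times> {0<..<b}" "emeasure lborel \<Omega> \<le> ennreal b"
    and b: "0 < b" "b \<le> 1" and \<phi>: "\<phi> \<in> test_functions \<Omega>"
  shows "((pi / b)\<^sup>2 + 3 / 2) * (LINT z:\<Omega>|lborel. (\<phi> z)\<^sup>2) \<le> (LINT z:\<Omega>|lborel. (norm (gradient \<phi> z))\<^sup>2)"
proof -
  define K where "K = closure {x. \<phi> x \<noteq> 0}"
  define fx where "fx = partial \<phi> (1, 0)"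
  define fy where "fy = partial \<phi> (0, 1)"
  have K: "compact K" "K \<subseteq> \<Omega>" unfolding K_def using \<phi> by (auto simp only: test_functions_def)
  have "{x. \<phi> x \<noteq> 0} \<subseteq> K" unfolding K_def by (rule closure_subset)
  then have out_K: "\<phi> z = 0" "fx z = 0" "fy z = 0" if "z \<notin> K" for z
    using that test_functions_partial_eq_0[OF \<phi>, of _ z, folded K_def] by (auto simp: fx_def fy_def Basis_plane)
  obtain R where R: "R > 0" "\<And>z. z \<in> K \<Longrightarrow> norm z < R"
    using compact_imp_bounded[OF K(1)] bounded_pos_less by blast
  have in_box: "\<bar>x\<bar> < R" "0 < y" "y < b" if "(x, y) \<in> K" for x y
    using that R(2)[OF that] norm_fst_le[of x y] K(2) \<Omega>(2) by force+
  have out: "\<phi> z = 0" "fx z = 0" "fy z = 0" if "z \<notin> cbox (-R, 0) (R, b)" for z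
    using that out_K[of z] in_box[of "fst z" "snd z"] by (cases z; force)+
  have cont: "continuous_on A \<phi>" "continuous_on A fx" "continuous_on A fy" for A
    using test_functions_continuous[OF \<phi>] test_functions_continuous[OF test_functions_partial[OF \<phi>]]
    by (auto simp: fx_def fy_def Basis_plane)
  have cont_slice: "continuous_on A (\<lambda>y. \<phi> (x, y))" "continuous_on A (\<lambda>y. fx (x, y))" "continuous_on A (\<lambda>y. fy (x, y))"
    for A x by (auto intro!: continuous_on_compose2[OF cont(1)[of UNIV]] continuous_on_compose2[OF cont(2)[of UNIV]]
      continuous_on_compose2[OF cont(3)[of UNIV]] continuous_intros)
  have dx: "((\<lambda>x. \<phi> (x, y)) has_field_derivative fx (x, y)) (at x within A)"
    and dy: "((\<lambda>y. \<phi> (x, y)) has_field_derivative fy (x, y)) (at y within A)" for x y A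
    unfolding fx_def fy_def
    using has_field_derivative_fst_snd[OF test_functions_has_derivative[OF \<phi>]] by auto
  define w where "w x = integral {0..b} (\<lambda>y. (\<phi> (x, y))\<^sup>2)" for x
  define w' where "w' x = integral {0..b} (\<lambda>y. 2 * \<phi> (x, y) * fx (x, y))" for x
  define q where "q x = integral {0..b} (\<lambda>y. (fx (x, y))\<^sup>2)" for x
  define r where "r x = integral {0..b} (\<lambda>y. (fy (x, y))\<^sup>2)" for x
  define l where "l x = measure lborel (Pair x -` \<Omega>)" for x
  have int: "(\<lambda>y. (\<phi> (x, y))\<^sup>2) integrable_on {0..b}" "(\<lambda>y. 2 * \<phi> (x, y) * fx (x, y)) integrable_on {0..b}"
    "(\<lambda>y. (fx (x, y))\<^sup>2) integrable_on {0..b}" for x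
    by (intro integrable_continuous_real continuous_intros cont_slice)+
  have deriv_w: "(w has_field_derivative w' x) (at x)" for x
    unfolding w_def w'_def cbox_interval[symmetric]
  proof (rule leibniz_rule_field_derivative[where U = UNIV])
    show "((\<lambda>x. (\<phi> (x, t))\<^sup>2) has_field_derivative 2 * \<phi> (x, t) * fx (x, t)) (at x)" for x t
      by (auto intro!: derivative_eq_intros dx)
    show "continuous_on (UNIV \<times> cbox 0 b) (\<lambda>(x, t). 2 * \<phi> (x, t) * fx (x, t))"
      unfolding case_prod_unfold prod.collapse by (intro continuous_intros cont)
  qed (use int in auto)
  have cont_w: "continuous_on UNIV q" "continuous_on UNIV r" "continuous_on UNIV w"
    unfolding q_def r_def w_def
    by (intro integral_param_continuous[of "\<lambda>z. (fx z)\<^sup>2"]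
      integral_param_continuous[of "\<lambda>z. (fy z)\<^sup>2"] integral_param_continuous[of "\<lambda>z. (\<phi> z)\<^sup>2"] continuous_intros cont)+
  have w_nonneg: "0 \<le> w x" for x
    unfolding w_def by (intro integral_nonneg int) auto
  have "\<phi> (R, y) = 0" "\<phi> (-R, y) = 0" for y
    using out_K(1) in_box(1) by fastforce+
  then have w_ends: "w (-R) = 0" "w R = 0" by (auto simp: w_def)
  \<comment> \<open>Integrating (fx - p \<phi>)^2 \<ge> 0 over the slice. Quantifying over
    \<open>p\<close> replaces the Cauchy-Schwarz bound w'^2 \<le> 4 w q and avoids both the square
    root of \<open>w\<close> and a division where \<open>w\<close> vanishes.\<close>
  have q_ge: "p * w' x - p\<^sup>2 * w x \<le> q x" for x p
  proof -
    have "p * w' x - p\<^sup>2 * w x = integral {0..b} (\<lambda>y. p * (2 * \<phi> (x, y) * fx (x, y)) - p\<^sup>2 * (\<phi> (x, y))\<^sup>2)"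
      unfolding w'_def w_def integral_mult_right[symmetric]
      by (rule integral_diff[symmetric]) (intro integrable_continuous_real continuous_intros cont_slice)+
    also have "\<dots> \<le> q x"
      unfolding q_def
    proof (rule integral_le)
      show "p * (2 * \<phi> (x, y) * fx (x, y)) - p\<^sup>2 * (\<phi> (x, y))\<^sup>2 \<le> (fx (x, y))\<^sup>2" for y
        using zero_le_power2[of "fx (x, y) - p * \<phi> (x, y)"] by (simp add: power2_eq_square algebra_simps)
    qed (intro integrable_continuous_real continuous_intros cont_slice)+
    finally show ?thesis .
  qed
  have slice_open: "open (Pair x -` \<Omega>)" for x
    by (intro open_vimage \<Omega>(1) continuous_intros)
  have slice_sub: "Pair x -` \<Omega> \<subseteq> {0<..<b}" for x using \<Omega>(2) by auto
  have l_le: "l x \<le> b" for x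
  proof -
    have "measure lborel (Pair x -` \<Omega>) \<le> measure lborel {0<..<b}"
      using slice_sub slice_open b(1) by (intro measure_mono_fmeasurable) (auto simp: fmeasurable_def)
    then show ?thesis using b(1) by (simp add: l_def)
  qed
  have r_ge: "2 * (pi / b)\<^sup>2 * (1 - l x / b) * w x \<le> r x - (pi / b)\<^sup>2 * w x" for x
  proof (cases "Pair x -` \<Omega> = {}")
    case True
    then have "\<phi> (x, y) = 0" "fy (x, y) = 0" for y using out_K(1,3)[of "(x, y)"] K(2) by auto
    then show ?thesis by (simp add: w_def r_def)
  next
    case False
    have "(pi / l x)\<^sup>2 * w x \<le> r x"
      unfolding l_def w_def r_def
    proof (rule faber_krahn_real[OF slice_open slice_sub])
      show "compact (snd ` (K \<inter> {x} \<times> UNIV))"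
        by (intro compact_continuous_image continuous_intros compact_Int_closed K(1) closed_Times closed_singleton closed_UNIV)
      show "snd ` (K \<inter> {x} \<times> UNIV) \<subseteq> Pair x -` \<Omega>" using K(2) by auto
      show "\<phi> (x, y) = 0" if "y \<notin> snd ` (K \<inter> {x} \<times> UNIV)" for y
      proof (rule out_K(1))
        show "(x, y) \<notin> K" using that by force
      qed
    qed (auto intro: dy cont_slice)
    moreover have "0 < l x"
    proof -
      obtain y where y: "y \<in> Pair x -` \<Omega>" using False by blast
      have "emeasure lborel (Pair x -` \<Omega>) \<le> emeasure lborel {0<..<b}"
        using slice_sub by (intro emeasure_mono) auto
      then have "emeasure lborel (Pair x -` \<Omega>) < \<infinity>" using b(1) by (auto intro: le_less_trans)
      from measure_less_has_derivative(2,3)[OF slice_open this y] show ?thesis by (simp add: l_def)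
    qed
    then have "((pi / b)\<^sup>2 + 2 * (pi / b)\<^sup>2 * (1 - l x / b)) * w x \<le> (pi / l x)\<^sup>2 * w x"
      by (intro mult_right_mono inverse_square_tangent l_le w_nonneg)
    ultimately show ?thesis by (simp add: distrib_right)
  qed
  \<comment> \<open>The restriction b \<le> 1 enters here: it makes the potential strong enough for
    the one-dimensional bound.\<close>
  have H: "4 \<le> 2 * (pi / b)\<^sup>2"
  proof -
    have "2 \<le> pi / b" using b pi_gt3 by (simp add: field_simps)
    then have "2\<^sup>2 \<le> (pi / b)\<^sup>2" by (intro power_mono) auto
    then show ?thesis by simp
  qed
  have "3 / 2 * integral {-R..R} w \<le> integral {-R..R} (\<lambda>x. q x + (r x - (pi / b)\<^sup>2 * w x))"
  proof (rule one_dimensional_bound[OF deriv_w w_nonneg w_ends R(1) cont_w(1) _ q_ge r_ge _ _ _ _ H])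
    show "continuous_on UNIV (\<lambda>x. r x - (pi / b)\<^sup>2 * w x)" by (intro continuous_intros cont_w)
    show "0 \<le> l x / b" "l x / b \<le> 1" for x using l_le b(1) by (auto simp: l_def)
    show "integrable lborel (\<lambda>x. l x / b)" "(LINT x|lborel. l x / b) \<le> 1"
      using integral_slice_measure[OF \<Omega>] b(1) by (auto simp: l_def)
  qed
  moreover have "integral {-R..R} (\<lambda>x. q x + (r x - (pi / b)\<^sup>2 * w x))
      = integral {-R..R} (\<lambda>x. q x + r x) - (pi / b)\<^sup>2 * integral {-R..R} w"
  proof -
    have "(\<lambda>x. q x + r x) integrable_on {-R..R}" "(\<lambda>x. (pi / b)\<^sup>2 * w x) integrable_on {-R..R}"
      by (intro integrable_continuous_real continuous_intros cont_w[THEN continuous_on_subset] subset_UNIV)+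
    from integral_diff[OF this] show ?thesis by (simp add: algebra_simps)
  qed
  moreover have "(LINT z:\<Omega>|lborel. (\<phi> z)\<^sup>2) = integral {-R..R} w"
  proof -
    have "(LINT z:\<Omega>|lborel. (\<phi> z)\<^sup>2) = (LINT z|lborel. (\<phi> z)\<^sup>2)"
      by (rule set_integral_eq_lborel(1)) (simp add: test_functions_support[OF \<phi>])
    also have "\<dots> = integral {-R..R} w"
      unfolding w_def by (rule lborel_integral_eq_iterated) (auto intro!: continuous_intros cont simp: out)
    finally show ?thesis .
  qed
  moreover have "(LINT z:\<Omega>|lborel. (norm (gradient \<phi> z))\<^sup>2) = integral {-R..R} (\<lambda>x. q x + r x)"
  proof -
    have "(LINT z:\<Omega>|lborel. (norm (gradient \<phi> z))\<^sup>2) = (LINT z:\<Omega>|lborel. (fx z)\<^sup>2 + (fy z)\<^sup>2)"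
      by (simp add: norm_gradient_plane fx_def fy_def)
    also have "\<dots> = (LINT z|lborel. (fx z)\<^sup>2 + (fy z)\<^sup>2)"
    proof (rule set_integral_eq_lborel(1))
      fix z assume "z \<notin> \<Omega>"
      then have "z \<notin> K" using K(2) by blast
      then show "(fx z)\<^sup>2 + (fy z)\<^sup>2 = 0" by (simp add: out_K(2,3))
    qed
    also have "\<dots> = integral {-R..R} (\<lambda>x. integral {0..b} (\<lambda>y. (fx (x, y))\<^sup>2 + (fy (x, y))\<^sup>2))"
      by (rule lborel_integral_eq_iterated) (auto intro!: continuous_intros cont simp: out)
    also have "(\<lambda>x. integral {0..b} (\<lambda>y. (fx (x, y))\<^sup>2 + (fy (x, y))\<^sup>2)) = (\<lambda>x. q x + r x)"
      unfolding q_def r_def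
      by (intro ext integral_add integrable_continuous_real continuous_intros cont_slice)
    finally show ?thesis .
  qed
  ultimately show ?thesis by (simp add: distrib_right)
qed

section \<open>Upper bound by superlevel sets\<close>

text \<open>The first Dirichlet eigenfunction of the rectangle (0, L) \<times> (0, b), normalised to
  have maximum 1.\<close>

definition rect_mode :: "real \<Rightarrow> real \<Rightarrow> real \<times> real \<Rightarrow> real" where
  "rect_mode L b z = sin (pi * fst z / L) * sin (pi * snd z / b)"

definition mode_domain :: "real \<Rightarrow> real \<Rightarrow> real \<Rightarrow> (real \<times> real) set" where
  "mode_domain L b e = {z \<in> {0<..<L} \<times> {0<..<b}. e < rect_mode L b z}"

text \<open>The cut is at 2 e although the domain is cut at e: the support then lies in the set
  where the mode is at least 2 e, which is compact inside the open domain. On the boundary of the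
  rectangle the shifted mode is - 2 e < 0, as the smooth zero extension requires.\<close>

definition mode_test :: "real \<Rightarrow> real \<Rightarrow> real \<Rightarrow> real \<times> real \<Rightarrow> real" where
  "mode_test L b e z = (if z \<in> {0<..<L} \<times> {0<..<b} then flat_function e 1 (rect_mode L b z - 2 * e) else 0)"

lemma smooth_rect_mode: "smooth (rect_mode L b)"
proof -
  have "smooth (\<lambda>z. sin (z \<bullet> (pi / L, 0) + 0) * sin (z \<bullet> (0, pi / b) + 0))"
    by (intro smooth_mult smooth_sin)
  moreover have "rect_mode L b = (\<lambda>z. sin (z \<bullet> (pi / L, 0) + 0) * sin (z \<bullet> (0, pi / b) + 0))"
    by (auto simp: rect_mode_def fun_eq_iff mult.commute)
  ultimately show ?thesis by simp
qed

lemma rect_mode_has_derivative: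
  assumes "0 < L" "0 < b"
  shows "(rect_mode L b has_derivative (\<lambda>v. pi / L * cos (pi * fst z / L) * sin (pi * snd z / b) * fst v
    + pi / b * sin (pi * fst z / L) * cos (pi * snd z / b) * snd v)) (at z)"
  unfolding rect_mode_def using assms
  by (auto intro!: derivative_eq_intros simp: fun_eq_iff algebra_simps)

lemma open_mode_domain: "open (mode_domain L b e)"
proof -
  have "mode_domain L b e = ({0<..<L} \<times> {0<..<b}) \<inter> {z. e < rect_mode L b z}"
    by (auto simp: mode_domain_def)
  then show ?thesis
    by (simp add: open_Int open_Times open_Collect_less smooth_continuous_on[OF smooth_rect_mode])
qed

lemma rect_mode_bounds:
  assumes "0 < L" "0 < b" "z \<in> cbox (0, 0) (L, b)"
  shows "0 \<le> rect_mode L b z" "rect_mode L b z \<le> 1"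
proof -
  obtain x y where z: "z = (x, y)" by (cases z)
  have xy: "0 \<le> x" "x \<le> L" "0 \<le> y" "y \<le> b" using assms(3) by (auto simp: z)
  have "0 \<le> sin (pi * x / L)" "0 \<le> sin (pi * y / b)"
    using xy assms(1,2) by (auto intro!: sin_ge_zero simp: field_simps)
  then show "0 \<le> rect_mode L b z" "rect_mode L b z \<le> 1"
    by (auto simp: rect_mode_def z intro!: mult_le_one)
qed

lemma rect_mode_boundary:
  assumes "0 < L" "0 < b" "z \<in> cbox (0, 0) (L, b)" "z \<notin> {0<..<L} \<times> {0<..<b}"
  shows "rect_mode L b z = 0"
proof -
  obtain x y where z: "z = (x, y)" by (cases z)
  have "x = 0 \<or> x = L \<or> y = 0 \<or> y = b" using assms(3,4) by (auto simp: z)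
  then show ?thesis using assms(1,2) by (auto simp: rect_mode_def z)
qed

lemma closure_rect_subset:
  "closure ({0<..<L} \<times> {0<..<b}) \<subseteq> cbox (0, 0) (L, b)" for L b :: real
  by (rule closure_minimal) auto

context
  fixes L b e :: real
  assumes pos: "0 < L" "0 < b" "0 < e"
begin

lemma mode_test_has_derivative:
  "(mode_test L b e has_derivative
    (\<lambda>v. (if z \<in> {0<..<L} \<times> {0<..<b} then flat_function e (flat_deriv e 1) (rect_mode L b z - 2 * e) else 0)
      * frechet_derivative (\<lambda>z. rect_mode L b z - 2 * e) (at z) v)) (at z)"
  and smooth_mode_test: "smooth (mode_test L b e)"
proof -
  have h: "smooth (\<lambda>z. rect_mode L b z - 2 * e)"
    using smooth_add[OF smooth_rect_mode smooth_const, of L b "- (2 * e)"] by simp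
  have op: "open ({0<..<L} \<times> {0<..<b})" by (intro open_Times) auto
  have neg: "rect_mode L b z - 2 * e < 0" if "z \<in> closure ({0<..<L} \<times> {0<..<b}) - {0<..<L} \<times> {0<..<b}" for z
    using that closure_rect_subset[of L b] rect_mode_boundary[OF pos(1,2), of z] pos(3) by auto
  show "(mode_test L b e has_derivative
    (\<lambda>v. (if z \<in> {0<..<L} \<times> {0<..<b} then flat_function e (flat_deriv e 1) (rect_mode L b z - 2 * e) else 0)
      * frechet_derivative (\<lambda>z. rect_mode L b z - 2 * e) (at z) v)) (at z)"
    unfolding mode_test_def by (rule flat_cutoff_has_derivative[OF pos(3) op h neg])
  show "smooth (mode_test L b e)"
    unfolding mode_test_def by (rule smooth_flat_cutoff[OF pos(3) op h neg])
qed

lemma mode_test_test_function: "mode_test L b e \<in> test_functions (mode_domain L b e)"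
proof -
  let ?C = "cbox (0, 0) (L, b) \<inter> {z. 2 * e \<le> rect_mode L b z}"
  have "closed {z. 2 * e \<le> rect_mode L b z}"
    by (intro closed_Collect_le smooth_continuous_on smooth_rect_mode smooth_const)
  then have C: "compact ?C" by (intro compact_Int_closed compact_cbox)
  have "?C \<subseteq> mode_domain L b e"
  proof
    fix z assume z: "z \<in> ?C"
    then have "z \<in> {0<..<L} \<times> {0<..<b}" using rect_mode_boundary[OF pos(1,2), of z] pos(3) by fastforce
    then show "z \<in> mode_domain L b e" using z pos(3) by (auto simp: mode_domain_def)
  qed
  moreover have "{z. mode_test L b e z \<noteq> 0} \<subseteq> ?C"
  proof
    fix z assume "z \<in> {z. mode_test L b e z \<noteq> 0}"
    then have z: "z \<in> {0<..<L} \<times> {0<..<b}" "flat_function e 1 (rect_mode L b z - 2 * e) \<noteq> 0"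
      by (auto simp: mode_test_def split: if_splits)
    then have "rect_mode L b z - 2 * e > 0"
      using flat_function_1(4,5)[OF pos(3), of "rect_mode L b z - 2 * e"] by simp
    then show "z \<in> ?C" using z(1) by auto
  qed
  then have "closure {z. mode_test L b e z \<noteq> 0} \<subseteq> ?C"
    by (rule closure_minimal) (rule compact_imp_closed[OF C])
  moreover from this have "compact (closure {z. mode_test L b e z \<noteq> 0})"
    using compact_closure[of "{z. mode_test L b e z \<noteq> 0}"] C compact_imp_bounded bounded_subset closure_subset
    by (metis (no_types, lifting) subset_trans)
  ultimately show ?thesis
    using smooth_mode_test by (auto simp: test_functions_def smooth_def)
qed

text \<open>The shift by 2 e and the flattening by e leave f \<ge> u - 3 e. Where u \<ge> 3 e this
  may be squared, and u \<le> 1 bounds the loss by 6 e; elsewhere u^2 \<le> 3 e u makes the left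
  side at most 0.\<close>

lemma mode_test_square_ge:
  assumes "z \<in> cbox (0, 0) (L, b)"
  shows "(rect_mode L b z)\<^sup>2 - 6 * e \<le> (mode_test L b e z)\<^sup>2"
proof -
  let ?u = "rect_mode L b z" and ?f = "mode_test L b e z"
  note u = rect_mode_bounds[OF pos(1,2) assms]
  have f: "?u - 3 * e \<le> ?f" "0 \<le> ?f"
    using flat_function_1(1,4)[OF pos(3), of "?u - 2 * e"] rect_mode_boundary[OF pos(1,2) assms] pos(3)
    by (auto simp: mode_test_def)
  have ue: "?u * e \<le> 1 * e" using u pos(3) by (intro mult_right_mono) auto
  show ?thesis
  proof (cases "3 * e \<le> ?u")
    case True
    then have "(?u - 3 * e)\<^sup>2 \<le> ?f\<^sup>2" using f by (intro power_mono) auto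
    moreover have "(?u - 3 * e)\<^sup>2 = ?u\<^sup>2 - 6 * (?u * e) + 9 * e\<^sup>2" by (simp add: power2_eq_square algebra_simps)
    ultimately show ?thesis using ue zero_le_power2[of e] by linarith
  next
    case False
    then have "?u * ?u \<le> ?u * (3 * e)" using u by (intro mult_left_mono) auto
    also have "?u * (3 * e) = 3 * (?u * e)" by simp
    finally have "?u\<^sup>2 - 6 * e \<le> 0" using ue pos(3) unfolding power2_eq_square by linarith
    then show ?thesis by (rule order_trans) simp
  qed
qed

lemma mode_test_gradient_le:
  "(norm (gradient (mode_test L b e) (x, y)))\<^sup>2 \<le>
    (pi / L)\<^sup>2 * ((cos (pi * x / L))\<^sup>2 * (sin (pi * y / b))\<^sup>2) + (pi / b)\<^sup>2 * ((sin (pi * x / L))\<^sup>2 * (cos (pi * y / b))\<^sup>2)"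
proof -
  let ?z = "(x, y)"
  let ?c = "if ?z \<in> {0<..<L} \<times> {0<..<b} then flat_function e (flat_deriv e 1) (rect_mode L b ?z - 2 * e) else 0"
  have "((\<lambda>z. rect_mode L b z - 2 * e) has_derivative (\<lambda>v. pi / L * cos (pi * x / L) * sin (pi * y / b) * fst v
    + pi / b * sin (pi * x / L) * cos (pi * y / b) * snd v)) (at ?z)"
    using has_derivative_diff[OF rect_mode_has_derivative[OF pos(1,2), of ?z] has_derivative_const[of "2 * e"]] by simp
  note D = mode_test_has_derivative[of ?z, unfolded frechet_derivative_at[OF this, symmetric]]
  have p: "partial (mode_test L b e) (1, 0) ?z = ?c * (pi / L * cos (pi * x / L) * sin (pi * y / b))"
    "partial (mode_test L b e) (0, 1) ?z = ?c * (pi / b * sin (pi * x / L) * cos (pi * y / b))"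
    unfolding frechet_derivative_at[OF D, symmetric] by simp_all
  have "0 \<le> ?c" "?c \<le> 1" using flat_function_1(2,3)[OF pos(3)] by auto
  then have "?c\<^sup>2 \<le> 1" by (simp add: power_le_one)
  then have c: "(?c * A)\<^sup>2 + (?c * B)\<^sup>2 \<le> A\<^sup>2 + B\<^sup>2" for A B :: real
    using mult_right_mono[of "?c\<^sup>2" 1 "A\<^sup>2 + B\<^sup>2"] by (simp only: power_mult_distrib distrib_left) simp
  have "(norm (gradient (mode_test L b e) ?z))\<^sup>2 \<le>
    (pi / L * cos (pi * x / L) * sin (pi * y / b))\<^sup>2 + (pi / b * sin (pi * x / L) * cos (pi * y / b))\<^sup>2"
    unfolding norm_gradient_plane p by (rule c)
  then show ?thesis by (simp only: power_mult_distrib mult.assoc)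
qed

end

section \<open>Mass and energy of the truncated mode\<close>

lemma integral_sin_squared:
  assumes "0 < a"
  shows "integral {0..a} (\<lambda>x. (sin (pi * x / a))\<^sup>2) = a / 2"
    and "integral {0..a} (\<lambda>x. (cos (pi * x / a))\<^sup>2) = a / 2"
proof -
  have cos2: "cos (2 * (pi * x / a)) = 1 - 2 * (sin (pi * x / a))\<^sup>2" for x by (rule cos_double_sin)
  have "((\<lambda>x. x / 2 - a / (4 * pi) * sin (2 * (pi * x / a))) has_field_derivative 1 / 2 - cos (2 * (pi * x / a)) / 2) (at x within A)" for x A
    using assms by (auto intro!: derivative_eq_intros simp: field_simps)
  then have d: "((\<lambda>x. x / 2 - a / (4 * pi) * sin (2 * (pi * x / a))) has_field_derivative (sin (pi * x / a))\<^sup>2) (at x within A)" for x A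
    unfolding cos2 by (simp add: diff_divide_distrib)
  show 1: "integral {0..a} (\<lambda>x. (sin (pi * x / a))\<^sup>2) = a / 2"
    using assms integral_eq_diff[OF _ d, of 0 a] by simp
  have "integral {0..a} (\<lambda>x. 1 - (sin (pi * x / a))\<^sup>2) = a - a / 2"
    using assms 1 by (subst integral_diff) (auto intro!: integrable_continuous_real continuous_intros)
  then show "integral {0..a} (\<lambda>x. (cos (pi * x / a))\<^sup>2) = a / 2"
    by (simp add: cos_squared_eq)
qed

lemma integral_box_product:
  fixes f g :: "real \<Rightarrow> real"
  assumes "continuous_on UNIV f" "continuous_on UNIV g"
  shows "integral (cbox (0, 0) (L, b)) (\<lambda>z. f (fst z) * g (snd z)) = integral {0..L} f * integral {0..b} g"
proof -
  have "continuous_on (cbox (0, 0) (L, b)) (\<lambda>z. f (fst z) * g (snd z))"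
    by (intro continuous_on_mult continuous_on_compose2[OF assms(1) continuous_on_fst[OF continuous_on_id] subset_UNIV]
      continuous_on_compose2[OF assms(2) continuous_on_snd[OF continuous_on_id] subset_UNIV])
  from integral_prod_continuous[OF this] show ?thesis by simp
qed

text \<open>Both pointwise estimates are integrated over the full rectangle, where the mode itself
  has mass L b / 4. The mass drops by at most a multiple of \<open>e\<close>, and the energy does
  not exceed that of the mode.\<close>

lemma mode_test_rayleigh:
  assumes pos: "0 < L" "0 < b" "0 < e"
  shows "L * b * (1 / 4 - 6 * e) \<le> (LINT z:mode_domain L b e|lborel. (mode_test L b e z)\<^sup>2)"
    and "(LINT z:mode_domain L b e|lborel. (norm (gradient (mode_test L b e) z))\<^sup>2)
      \<le> ((pi / L)\<^sup>2 + (pi / b)\<^sup>2) * (L * b / 4)"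
proof -
  let ?\<phi> = "mode_test L b e" and ?B = "cbox (0, 0) (L, b)"
  note T = mode_test_test_function[OF pos]
  have sub: "mode_domain L b e \<subseteq> ?B" by (auto simp: mode_domain_def)
  have cont: "continuous_on A ?\<phi>" "continuous_on A (gradient ?\<phi>)" "continuous_on A (rect_mode L b)" for A
    using test_functions_continuous[OF T] gradient_continuous[OF T] smooth_continuous_on[OF smooth_rect_mode] by auto
  have out: "?\<phi> z = 0" "gradient ?\<phi> z = 0" if "z \<notin> mode_domain L b e" for z
  proof -
    show "?\<phi> z = 0" by (rule test_functions_support[OF T that])
    have "z \<notin> closure {x. ?\<phi> x \<noteq> 0}" using T that unfolding test_functions_def by blast
    then show "gradient ?\<phi> z = 0" by (rule gradient_eq_0[OF T])
  qed
  have out_box: "?\<phi> z = 0" "gradient ?\<phi> z = 0" if "z \<notin> ?B" for z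
    using out[of z] sub that by blast+
  have sin_cont: "continuous_on UNIV (\<lambda>x. (sin (pi * x / a))\<^sup>2)" "continuous_on UNIV (\<lambda>x. (cos (pi * x / a))\<^sup>2)" for a
    by (simp_all only: divide_inverse) (intro continuous_intros)+
  note box = integral_box_product[OF sin_cont(1) sin_cont(1), of L b L b]
    integral_box_product[OF sin_cont(2) sin_cont(1), of L b L b]
    integral_box_product[OF sin_cont(1) sin_cont(2), of L b L b]
  note box = box[unfolded integral_sin_squared[OF pos(1)] integral_sin_squared[OF pos(2)]]
  have "L * b * (1 / 4 - 6 * e) = integral ?B (\<lambda>z. (rect_mode L b z)\<^sup>2) - integral ?B (\<lambda>z. 6 * e)"
    using pos by (simp add: rect_mode_def power_mult_distrib box content_Pair right_diff_distrib)
  also have "\<dots> = integral ?B (\<lambda>z. (rect_mode L b z)\<^sup>2 - 6 * e)"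
    by (rule integral_diff[symmetric]) (intro integrable_continuous continuous_intros cont)+
  also have "\<dots> \<le> integral ?B (\<lambda>z. (?\<phi> z)\<^sup>2)"
    by (intro integral_le integrable_continuous continuous_intros cont mode_test_square_ge[OF pos])
  also have "\<dots> = (LINT z|lborel. (?\<phi> z)\<^sup>2)"
  proof (rule lborel_integral_eq_box[symmetric])
    show "continuous_on UNIV (\<lambda>z. (?\<phi> z)\<^sup>2)" by (intro continuous_intros cont)
    show "(?\<phi> z)\<^sup>2 = 0" if "z \<notin> ?B" for z using out_box(1)[OF that] by simp
  qed
  also have "\<dots> = (LINT z:mode_domain L b e|lborel. (?\<phi> z)\<^sup>2)"
    by (rule set_integral_eq_lborel(1)[symmetric]) (simp add: out)
  finally show "L * b * (1 / 4 - 6 * e) \<le> (LINT z:mode_domain L b e|lborel. (?\<phi> z)\<^sup>2)" .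
  let ?D = "\<lambda>z. (pi / L)\<^sup>2 * ((cos (pi * fst z / L))\<^sup>2 * (sin (pi * snd z / b))\<^sup>2)"
  let ?E = "\<lambda>z. (pi / b)\<^sup>2 * ((sin (pi * fst z / L))\<^sup>2 * (cos (pi * snd z / b))\<^sup>2)"
  have DE: "continuous_on ?B ?D" "continuous_on ?B ?E"
    by (simp_all only: divide_inverse) (intro continuous_intros)+
  have "(LINT z:mode_domain L b e|lborel. (norm (gradient ?\<phi> z))\<^sup>2) = (LINT z|lborel. (norm (gradient ?\<phi> z))\<^sup>2)"
    by (rule set_integral_eq_lborel(1)) (simp add: out)
  also have "\<dots> = integral ?B (\<lambda>z. (norm (gradient ?\<phi> z))\<^sup>2)"
  proof (rule lborel_integral_eq_box)
    show "continuous_on UNIV (\<lambda>z. (norm (gradient ?\<phi> z))\<^sup>2)" by (intro continuous_intros cont)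
    show "(norm (gradient ?\<phi> z))\<^sup>2 = 0" if "z \<notin> ?B" for z using out_box(2)[OF that] by simp
  qed
  also have "\<dots> \<le> integral ?B (\<lambda>z. ?D z + ?E z)"
  proof (rule integral_le)
    show "(norm (gradient ?\<phi> z))\<^sup>2 \<le> ?D z + ?E z" for z
      using mode_test_gradient_le[OF pos, of "fst z" "snd z"] by simp
  qed (intro integrable_continuous continuous_intros cont DE)+
  also have "\<dots> = integral ?B ?D + integral ?B ?E"
    by (intro integral_add integrable_continuous DE)
  also have "\<dots> = ((pi / L)\<^sup>2 + (pi / b)\<^sup>2) * (L * b / 4)"
    by (simp add: box distrib_right)
  finally show "(LINT z:mode_domain L b e|lborel. (norm (gradient ?\<phi> z))\<^sup>2)
      \<le> ((pi / L)\<^sup>2 + (pi / b)\<^sup>2) * (L * b / 4)" .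
qed

text \<open>From one box to the next the width halves and the height doubles, so the area does not
  depend on \<open>i\<close>. This is the source of the logarithm: n boxes fit when e is about
  2^(-n).\<close>

lemma measure_corner_box:
  fixes L b e :: real
  assumes "0 < L" "0 < b" "0 < e"
  shows "measure lborel (box (L / 2 ^ Suc i, 0) (L / 2 ^ i, e * 2 ^ i * b / pi\<^sup>2)) = L * b * (e / (2 * pi\<^sup>2))"
proof -
  have "measure lborel (box (L / 2 ^ Suc i, 0) (L / 2 ^ i, e * 2 ^ i * b / pi\<^sup>2))
      = (\<Prod>k\<in>Basis. ((L / 2 ^ i, e * 2 ^ i * b / pi\<^sup>2) - (L / 2 ^ Suc i, 0)) \<bullet> k)"
    using assms by (subst measure_lborel_box_eq) (auto simp: Basis_plane field_simps)
  also have "\<dots> = (L / 2 ^ i - L / 2 ^ Suc i) * (e * 2 ^ i * b / pi\<^sup>2)"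
    by (simp add: Basis_plane)
  also have "\<dots> = L * b * (e / (2 * pi\<^sup>2))" by (simp add: field_simps)
  finally show ?thesis .
qed

lemma measure_rect:
  assumes "0 < L" "0 < b"
  shows "measure lborel ({0<..<L} \<times> {0<..<b}) = L * b" "emeasure lborel ({0<..<L} \<times> {0<..<b}) < \<infinity>"
proof -
  have "{0<..<L} \<times> {0<..<b} = box (0, 0) (L, b)"
    by (auto simp: box_def Basis_plane)
  then show "measure lborel ({0<..<L} \<times> {0<..<b}) = L * b" "emeasure lborel ({0<..<L} \<times> {0<..<b}) < \<infinity>"
    using assms by (auto simp: measure_lborel_box_eq emeasure_lborel_box_eq Basis_plane)
qed

text \<open>
  Near the corner \<open>(0, 0)\<close> the set where the mode is at most \<open>e\<close> contains the hyperbolic region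
  \<open>x y \<le> e L b / \<pi>\<^sup>2\<close>, whose area is of order \<open>e ln (1 / e)\<close>; the dyadic boxes fill
  a fixed proportion of it.
\<close>

lemma emeasure_mode_domain_le:
  assumes pos: "0 < L" "0 < b" "0 < e" and n: "e * 2 ^ n \<le> 1"
  shows "emeasure lborel (mode_domain L b e) \<le> ennreal (L * b * (1 - real n * (e / (2 * pi\<^sup>2))))"
proof -
  define A where "A i = box (L / 2 ^ Suc i, 0) (L / 2 ^ i, e * 2 ^ i * b / pi\<^sup>2)" for i :: nat
  let ?S = "{0<..<L} \<times> {0<..<b}" and ?\<Omega> = "mode_domain L b e"
  have A_iff: "(x, y) \<in> A i \<longleftrightarrow> L / 2 ^ Suc i < x \<and> x < L / 2 ^ i \<and> 0 < y \<and> y < e * 2 ^ i * b / pi\<^sup>2" for x y i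
    by (auto simp: A_def box_def Basis_plane)
  have A_sub: "A i \<subseteq> ?S - ?\<Omega>" if "i < n" for i
  proof
    fix z assume "z \<in> A i"
    then obtain x y where z: "z = (x, y)" and xy: "L / 2 ^ Suc i < x" "x < L / 2 ^ i" "0 < y" "y < e * 2 ^ i * b / pi\<^sup>2"
      using A_iff by (cases z) auto
    have "0 < L / 2 ^ Suc i" using pos by simp
    with xy have x0: "0 < x" by linarith
    have "L / 2 ^ i \<le> L / 1" using pos(1) by (intro divide_left_mono) auto
    with xy have xL: "x < L" by simp
    \<comment> \<open>The bound on \<open>n\<close> keeps the tallest box below height
      \<open>b\<close>, hence inside the rectangle.\<close>
    have "e * 2 ^ i \<le> e * 2 ^ n" using that pos by (intro mult_left_mono power_increasing) auto
    with n have "e * 2 ^ i \<le> 1" by linarith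
    moreover have "1 \<le> pi\<^sup>2" using pi_gt3 by (intro one_le_power) auto
    ultimately have "e * 2 ^ i \<le> pi\<^sup>2" by linarith
    then have "e * 2 ^ i * b \<le> pi\<^sup>2 * b" using pos by (intro mult_right_mono) auto
    then have "e * 2 ^ i * b / pi\<^sup>2 \<le> b" by (simp add: divide_le_eq mult.commute)
    with xy have yb: "y < b" by linarith
    have "sin (pi * x / L) \<le> pi * x / L" "sin (pi * y / b) \<le> pi * y / b"
      using x0 xy(3) pos by (auto intro!: sin_x_le_x)
    moreover have "0 \<le> sin (pi * y / b)" using xy(3) yb pos by (intro sin_ge_zero) (auto simp: field_simps)
    ultimately have "rect_mode L b z \<le> (pi * x / L) * (pi * y / b)"
      unfolding rect_mode_def z using x0 pos by (intro mult_mono) auto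
    \<comment> \<open>The upper right corner of the box lies on the hyperbola, so the powers of two
      cancel and exactly \<open>e\<close> remains.\<close>
    also have "\<dots> \<le> (pi / 2 ^ i) * (e * 2 ^ i / pi)"
    proof (rule mult_mono)
      show "pi * x / L \<le> pi / 2 ^ i" using xy(2) pos by (simp add: field_simps)
      show "pi * y / b \<le> e * 2 ^ i / pi" using xy(4) pos by (simp add: field_simps power2_eq_square)
    qed (use pos xy(3) in auto)
    also have "\<dots> = e" by simp
    finally show "z \<in> ?S - ?\<Omega>" using x0 xL xy(3) yb by (auto simp: z mode_domain_def)
  qed
  have disj: "disjoint_family_on A {..<n}"
    unfolding disjoint_family_on_def
  proof (intro ballI impI)
    have *: "A i \<inter> A k = {}" if "i < k" for i k
    proof -
      have "L / 2 ^ k \<le> L / 2 ^ Suc i" using that pos(1) by (intro divide_left_mono power_increasing) auto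
      then show ?thesis using A_iff by fastforce
    qed
    show "A i \<inter> A k = {}" if "i \<noteq> k" for i k
      using *[of i k] *[of k i] that by (cases i k rule: linorder_cases) auto
  qed
  have A_sets: "A i \<in> sets lborel" for i by (simp add: A_def)
  have \<Omega>_sets: "?\<Omega> \<in> sets lborel" using open_mode_domain by simp
  have \<Omega>_sub: "?\<Omega> \<subseteq> ?S" by (auto simp: mode_domain_def)
  have S_sets: "?S \<in> sets lborel" by (simp add: open_Times)
  have fin: "emeasure lborel X \<noteq> \<infinity>" if "X \<subseteq> ?S" for X
    using emeasure_mono[OF that S_sets] measure_rect(2)[OF pos(1,2)] by (auto simp: top_unique)
  have "measure lborel (\<Union>i<n. A i) = (\<Sum>i<n. measure lborel (A i))"
    using A_sets disj fin A_sub by (intro measure_finite_Union) auto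
  also have "\<dots> = real n * (L * b * (e / (2 * pi\<^sup>2)))"
    unfolding A_def measure_corner_box[OF pos] by simp
  finally have UA: "measure lborel (\<Union>i<n. A i) = real n * (L * b * (e / (2 * pi\<^sup>2)))" .
  define U where "U = (\<Union>i<n. A i)"
  have U_sub: "U \<subseteq> ?S - ?\<Omega>" using A_sub by (auto simp: U_def)
  have U_sets: "U \<in> sets lborel" unfolding U_def using A_sets by (intro sets.finite_UN) auto
  have "measure lborel ?\<Omega> + measure lborel U = measure lborel (?\<Omega> \<union> U)"
    using U_sub \<Omega>_sub by (intro measure_Union[symmetric] fin U_sets \<Omega>_sets) auto
  also have "\<dots> \<le> measure lborel ?S"
    using U_sub \<Omega>_sub U_sets \<Omega>_sets S_sets measure_rect(2)[OF pos(1,2)]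
    by (intro measure_mono_fmeasurable) (auto simp: fmeasurable_def)
  finally have "measure lborel ?\<Omega> \<le> L * b * (1 - real n * (e / (2 * pi\<^sup>2)))"
    unfolding U_def UA measure_rect(1)[OF pos(1,2)] by (simp add: right_diff_distrib mult.assoc mult.left_commute)
  then show ?thesis
    using fin[OF \<Omega>_sub] by (simp add: emeasure_eq_ennreal_measure ennreal_leI)
qed

section \<open>Two-sided control of \<open>j\<close> and the threshold\<close>

lemma j_ge:
  assumes b: "0 < b" "b \<le> 1"
  shows "(pi / b)\<^sup>2 + 3 / 2 \<le> j b"
  unfolding j_def
proof (rule cInf_greatest)
  \<comment> \<open>This rectangle has area exactly \<open>b\<close>; it shows that the infimum is
    over a nonempty set.\<close>
  let ?S = "{0<..<1::real} \<times> {0<..<b}"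
  have "emeasure lborel ?S = ennreal b"
    using measure_rect[of 1 b] b(1) by (simp add: emeasure_eq_ennreal_measure)
  moreover have "open ?S" by (intro open_Times) auto
  moreover have "?S \<noteq> {}" using b(1) by auto
  ultimately show "{lambda1 \<Omega> | \<Omega> :: (real \<times> real) set.
     open \<Omega> \<and> \<Omega> \<noteq> {} \<and> \<Omega> \<subseteq> UNIV \<times> {0<..<b} \<and> emeasure lborel \<Omega> \<le> ennreal b} \<noteq> {}"
    by (auto intro!: exI[of _ ?S])
next
  fix x assume "x \<in> {lambda1 \<Omega> | \<Omega> :: (real \<times> real) set.
     open \<Omega> \<and> \<Omega> \<noteq> {} \<and> \<Omega> \<subseteq> UNIV \<times> {0<..<b} \<and> emeasure lborel \<Omega> \<le> ennreal b}"
  then obtain \<Omega> :: "(real \<times> real) set" where "x = lambda1 \<Omega>"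
    and \<Omega>: "open \<Omega>" "\<Omega> \<noteq> {}" "\<Omega> \<subseteq> UNIV \<times> {0<..<b}" "emeasure lborel \<Omega> \<le> ennreal b"
    by blast
  then show "(pi / b)\<^sup>2 + 3 / 2 \<le> x"
    using lambda1_ge[OF \<Omega>(1,2) _ strip_poincare[OF \<Omega>(1,3,4) b]] by simp
qed

lemma j_le:
  fixes \<Omega> :: "(real \<times> real) set"
  assumes "open \<Omega>" "\<Omega> \<noteq> {}" "\<Omega> \<subseteq> UNIV \<times> {0<..<b}" "emeasure lborel \<Omega> \<le> ennreal b"
  shows "j b \<le> lambda1 \<Omega>"
  unfolding j_def
proof (rule cInf_lower)
  show "bdd_below {lambda1 \<Omega> | \<Omega> :: (real \<times> real) set.
     open \<Omega> \<and> \<Omega> \<noteq> {} \<and> \<Omega> \<subseteq> UNIV \<times> {0<..<b} \<and> emeasure lborel \<Omega> \<le> ennreal b}"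
  proof (rule bdd_belowI[of _ 0])
    fix y assume "y \<in> {lambda1 \<Omega> | \<Omega> :: (real \<times> real) set.
     open \<Omega> \<and> \<Omega> \<noteq> {} \<and> \<Omega> \<subseteq> UNIV \<times> {0<..<b} \<and> emeasure lborel \<Omega> \<le> ennreal b}"
    then obtain \<Omega> :: "(real \<times> real) set" where "y = lambda1 \<Omega>" "open \<Omega>" "\<Omega> \<noteq> {}" by blast
    then show "0 \<le> y"
      using lambda1_ge[of \<Omega> 0] set_integral_norm_squared_nonneg[of \<Omega> "gradient _"] by simp
  qed
qed (use assms in blast)

lemma exists_better_than_rectangle:
  fixes K :: real
  assumes "1 < K"
  obtains b and \<Omega> :: "(real \<times> real) set" where "0 < b" "b < 1 / sqrt (K\<^sup>2 - 1)" "open \<Omega>" "\<Omega> \<noteq> {}"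
    "\<Omega> \<subseteq> UNIV \<times> {0<..<b}" "emeasure lborel \<Omega> \<le> ennreal b" "lambda1 \<Omega> \<le> K\<^sup>2 * pi\<^sup>2"
proof -
  \<comment> \<open>\<open>n\<close> is fixed before \<open>e\<close>: each box saves the fraction e
    / (2 pi^2) of the area, and this many save at least 24 K^2 e, however small \<open>e\<close>
    is.\<close>
  obtain n :: nat where n: "48 * pi\<^sup>2 * K\<^sup>2 \<le> real n" using real_arch_simple by blast
  \<comment> \<open>The factor 2^(-n) makes room for \<open>n\<close> boxes; the other factors give
    e \<le> 1 / 100 and z \<le> 24 / 100.\<close>
  define e where "e = 1 / (100 * K\<^sup>2 * 2 ^ n)"
  \<comment> \<open>Truncation keeps at least the fraction 1 - 24 e of the mass, so a quotient of at
    most K^2 pi^2 is secured by 1 / L^2 + 1 / b^2 = K^2 (1 - 24 e) = K^2 - z. Here \<open>D\<close>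
    is 1 / b^2 solved from this equation, and L = 1 + z respects the area since (1 + z) (1 - z)
    \<le> 1.\<close>
  define z where "z = 24 * K\<^sup>2 * e"
  define L where "L = 1 + z"
  define D where "D = K\<^sup>2 - z - 1 / L\<^sup>2"
  define b where "b = 1 / sqrt D"
  have K: "1 < K\<^sup>2" using assms by (simp add: one_less_power)
  have "1 \<le> K\<^sup>2 * 2 ^ n" using K by (intro mult_ge1_I) auto
  then have e: "0 < e" "e \<le> 1 / 100" using K by (auto simp: e_def field_simps)
  have "e * 2 ^ n = 1 / (100 * K\<^sup>2)" by (simp add: e_def)
  also have "\<dots> \<le> 1" using K by (simp add: divide_le_eq)
  finally have en: "e * 2 ^ n \<le> 1" .
  have "z = 24 / (100 * 2 ^ n)" using assms by (simp add: z_def e_def)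
  also have "\<dots> \<le> 24 / 100" by (intro divide_left_mono) auto
  finally have z: "0 < z" "z \<le> 24 / 100" using assms e by (auto simp: z_def)
  have L: "0 < L" using z by (simp add: L_def)
  \<comment> \<open>The gain from lengthening beats the loss from truncation: (1 - z) (1 + z)^2 = 1
    + z - z^2 - z^3 > 1 for small z, which is what puts \<open>b\<close> below the threshold of the
    rectangle.\<close>
  have "z * (z * z) \<le> z * z" using z by (intro mult_left_mono) (auto intro: mult_le_one)
  moreover have "z * z < z / 2" using z mult_strict_left_mono[of z "1 / 2" z] by simp
  moreover have "(1 - z) * L\<^sup>2 = 1 + z - z * z - z * (z * z)"
    by (simp add: L_def power2_eq_square algebra_simps)
  ultimately have "1 < (1 - z) * L\<^sup>2" using z by linarith
  then have "1 / L\<^sup>2 < 1 - z" using L by (simp add: divide_less_eq)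
  then have D: "K\<^sup>2 - 1 < D" by (simp add: D_def)
  then have D0: "0 < D" using K by simp
  have b: "0 < b" "1 / b\<^sup>2 = D" using D0 by (auto simp: b_def power_divide)
  have b_less: "b < 1 / sqrt (K\<^sup>2 - 1)"
    unfolding b_def using D K D0 by (intro divide_strict_left_mono real_sqrt_less_mono mult_pos_pos) auto
  let ?\<Omega> = "mode_domain L b e"
  note pos = L b(1) e(1)
  have "real n * (e / (2 * pi\<^sup>2)) \<ge> 48 * pi\<^sup>2 * K\<^sup>2 * (e / (2 * pi\<^sup>2))"
    using n e(1) by (intro mult_right_mono) auto
  also have "48 * pi\<^sup>2 * K\<^sup>2 * (e / (2 * pi\<^sup>2)) = z" by (simp add: z_def)
  finally have "L * (1 - real n * (e / (2 * pi\<^sup>2))) \<le> L * (1 - z)"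
    using L by (intro mult_left_mono) auto
  also have "\<dots> \<le> 1" by (simp add: L_def algebra_simps)
  finally have "b * (L * (1 - real n * (e / (2 * pi\<^sup>2)))) \<le> b * 1"
    using b(1) by (intro mult_left_mono) auto
  then have area: "emeasure lborel ?\<Omega> \<le> ennreal b"
    using emeasure_mode_domain_le[OF pos en] by (auto intro!: ennreal_leI elim!: order_trans simp: mult.assoc mult.left_commute)
  have "rect_mode L b (L / 2, b / 2) = 1" using pos by (simp add: rect_mode_def)
  then have center: "(L / 2, b / 2) \<in> ?\<Omega>" "mode_test L b e (L / 2, b / 2) \<noteq> 0"
    using pos e(2) flat_function_1(5)[OF e(1), of "1 - 2 * e"] by (auto simp: mode_domain_def mode_test_def)
  note T = mode_test_test_function[OF pos]
  have "lambda1 ?\<Omega> \<le> (LINT x:?\<Omega>|lborel. (norm (gradient (mode_test L b e) x))\<^sup>2) / (LINT x:?\<Omega>|lborel. (mode_test L b e x)\<^sup>2)"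
    by (rule lambda1_le[OF T center(2)])
  also have "\<dots> \<le> (((pi / L)\<^sup>2 + (pi / b)\<^sup>2) * (L * b / 4)) / (L * b * (1 / 4 - 6 * e))"
    using mode_test_rayleigh[OF pos] pos e(2) by (intro frac_le) auto
  also have "\<dots> = ((pi / L)\<^sup>2 + (pi / b)\<^sup>2) / (1 - 24 * e)"
    using pos e(2) by (simp add: divide_simps)
  also have "(pi / L)\<^sup>2 + (pi / b)\<^sup>2 = pi\<^sup>2 * (1 / L\<^sup>2 + 1 / b\<^sup>2)"
    by (simp add: power_divide distrib_left)
  also have "1 / L\<^sup>2 + 1 / b\<^sup>2 = K\<^sup>2 * (1 - 24 * e)"
    unfolding b(2) by (simp add: D_def z_def algebra_simps)
  also have "pi\<^sup>2 * (K\<^sup>2 * (1 - 24 * e)) / (1 - 24 * e) = K\<^sup>2 * pi\<^sup>2"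
    using e(2) by simp
  finally have "lambda1 ?\<Omega> \<le> K\<^sup>2 * pi\<^sup>2" .
  moreover have "?\<Omega> \<subseteq> UNIV \<times> {0<..<b}" by (auto simp: mode_domain_def)
  ultimately show ?thesis
    using that[OF b(1) b_less open_mode_domain _ _ area] center(1) by blast
qed

theorem proposition2p3:
  fixes k :: int
  assumes "k \<ge> 2"
  shows "1 / sqrt ((real_of_int k)\<^sup>2 - 1 / 8) \<le> b_S k \<and>
         b_S k < 1 / sqrt ((real_of_int k)\<^sup>2 - 1)"
proof -
  define K where "K = real_of_int k"
  define X where "X = {b. 0 < b \<and> b \<le> 1 \<and> j b > K\<^sup>2 * pi\<^sup>2}"
  define B where "B = 1 / sqrt (K\<^sup>2 - 1 / 8)"
  have bS: "b_S k = Sup X" by (simp add: b_S_def X_def K_def)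
  have K: "2 \<le> K" using assms by (simp add: K_def)
  then have K2: "4 \<le> K\<^sup>2" using power_mono[of 2 K 2] by simp
  have B: "0 < B" "B \<le> 1" using K2 by (auto simp: B_def)
  have bdd: "bdd_above X" by (rule bdd_aboveI[of _ 1]) (simp add: X_def)
  have in_X: "b \<in> X" if "0 < b" "b < B" for b
  proof -
    have "b\<^sup>2 < B\<^sup>2" using that by (intro power_strict_mono) auto
    also have "B\<^sup>2 = 1 / (K\<^sup>2 - 1 / 8)" using K2 by (simp add: B_def power_divide)
    finally have "K\<^sup>2 - 1 / 8 < 1 / b\<^sup>2" using that K2 by (simp add: field_simps)
    then have "pi\<^sup>2 * (K\<^sup>2 - 1 / 8) < pi\<^sup>2 * (1 / b\<^sup>2)" by (intro mult_strict_left_mono) auto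
    \<comment> \<open>12 is 8 times 3/2, so the gain in \<open>j_ge\<close> covers pi^2 / 8;
      strictness comes from b < B.\<close>
    moreover have "pi\<^sup>2 \<le> 12"
    proof -
      have "pi\<^sup>2 \<le> (16 / 5)\<^sup>2" using pi_approx by (intro power_mono) auto
      then show ?thesis by (simp add: power2_eq_square)
    qed
    ultimately have "K\<^sup>2 * pi\<^sup>2 < (pi / b)\<^sup>2 + 3 / 2"
      by (simp add: power_divide algebra_simps)
    also have "\<dots> \<le> j b" using that B(2) by (intro j_ge) auto
    finally show ?thesis using that B(2) by (simp add: X_def)
  qed
  have lower: "B \<le> Sup X"
  proof (rule dense_le_bounded[OF B(1)])
    show "b \<le> Sup X" if "0 < b" "b < B" for b
      using in_X[OF that] bdd by (rule cSup_upper)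
  qed
  obtain b and \<Omega> :: "(real \<times> real) set" where b: "0 < b" "b < 1 / sqrt (K\<^sup>2 - 1)" and \<Omega>: "open \<Omega>" "\<Omega> \<noteq> {}"
    "\<Omega> \<subseteq> UNIV \<times> {0<..<b}" "emeasure lborel \<Omega> \<le> ennreal b" and le: "lambda1 \<Omega> \<le> K\<^sup>2 * pi\<^sup>2"
    using exists_better_than_rectangle[of K] K by auto
  have "Sup X \<le> b"
  proof (rule cSup_least)
    show "X \<noteq> {}" using in_X[of "B / 2"] B(1) by auto
    show "c \<le> b" if "c \<in> X" for c
    proof (rule ccontr)
      assume "\<not> c \<le> b"
      \<comment> \<open>The witness for \<open>b\<close> is admissible in the wider strip with the
        larger area bound, which forces j(c) \<le> K^2 pi^2.\<close>
      then have "b \<le> c" by simp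
      then have "\<Omega> \<subseteq> UNIV \<times> {0<..<c}" "emeasure lborel \<Omega> \<le> ennreal c"
        using \<Omega>(3) order_trans[OF \<Omega>(4) ennreal_leI] by auto
      from j_le[OF \<Omega>(1,2) this] le that show False by (simp add: X_def)
    qed
  qed
  then show ?thesis using lower b(2) by (simp add: bS B_def K_def)
qed

end
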